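(* Let $\mathbb{C}$ be a double category. A lax double presheaf $X\colon\mathbb{C}^{\mathrm{op}}\to\mathbb{C}\mathrm{at}$ is represented by an object if and only if its Grothendieck construction $\int\!\!\!\int_{\mathbb{C}}X$ has a double terminal object.
   Context: **Double categories.** A (strict) double category $\mathbb{C}$ has objects; horizontal morphisms $f\colon x\to y$ (composition $g\circ f$, identities $1_x$); vertical morphisms $u\colon x\nrightarrow x'$ (composition $u'\bullet u$, identities $e_x$); and squares $\alpha\colon[u\,{}^{f}_{f'}\,v]$ with left boundary $u\colon x\nrightarrow x'$, right boundary $v\colon y\nrightarrow y'$, top $f\colon x\to y$ and bottom $f'\colon x'\to y'$. Squares compose horizontally ($\beta\circ\alpha$, along a common vertical morphism, identities $1_u$) and vertically ($\alpha'\bullet\alpha$, along a common horizontal morphism, identities $e_f$). All compositions are strictly associative and unital, satisfy interchange, and $e_g\circ e_f=e_{g\circ f}$, $1_{u'}\bullet 1_u=1_{u'\bullet u}$, $e_{1_x}=1_{e_x}$. $\mathbb{C}^{\mathrm{op}}$ is obtained by reversing horizontal morphisms and squares horizontally. **Profunctors.** A profunctor $U\colon \mathcal{A}\nrightarrow\mathcal{A}'$ is a functor $\mathcal{A}^{\mathrm{op}}\times\mathcal{A}'\to\mathrm{Set}$. Composition: $(U'\bullet U)(a,a'')=\int^{a'}U'(a',a'')\times U(a,a')$; the class of $(s',s)$ is $[s',s]$. The identity profunctor is the hom functor, and one chooses $U\bullet e_{\mathcal{A}}=U=e_{\mathcal{A}'}\bullet U$ via the co-Yoneda isomorphisms. $\mathbb{C}\mathrm{at}$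 is the weak double category of small categories, functors (horizontal), profunctors (vertical), with squares $[U\,{}^{F}_{F'}\,V]$ the natural transformations $U\Rightarrow V(F^{\mathrm{op}}\times F')$. **Lax double presheaves.** A lax double presheaf over $\mathbb{C}$ is a normal lax double functor $X\colon\mathbb{C}^{\mathrm{op}}\to\mathbb{C}\mathrm{at}$. Explicitly: a category $Xx$ for each object $x$; a functor $Xf\colon Xy\to Xx$ for each horizontal $f\colon x\to y$; a profunctor $Xu\colon Xx^{\mathrm{op}}\times Xx'\to\mathrm{Set}$ for each vertical $u\colon x\nrightarrow x'$; a natural transformation $X\alpha\colon Xv\Rightarrow Xu(Xf^{\mathrm{op}}\times Xf')$ for each square $\alpha\colon[u\,{}^{f}_{f'}\,v]$; and a natural transformation $\mu_{u,u'}\colon Xu'\bullet Xu\Rightarrow X(u'\bullet u)$ for all composable vertical $u,u'$; such that (i) horizontal compositions and identities (of horizontal morphisms and of squares) are preserved strictly; (ii) $\mu$ is natural: $X(\alpha'\bullet\alpha)\circ\mu_{v,v'}=\mu_{u,u'}(Xf^{\mathrm{op}}\times Xf'')\circ(X\alpha'\bullet X\alpha)$ for vertically composable squares $\alpha\colon[u\,{}^{f}_{f'}\,v]$, $\alpha'\colon[u'\,{}^{f'}_{f''}\,v']$, and associative: $\mu_{u,u''\bullet u'}\circ(\mu_{u',u''}\bullet Xu)=\mu_{u'\bullet u,u''}\circ(Xu''\bullet\mu_{u,u'})$ up to the associator of profunctor composition; (iii) normality: $Xe_x$ is the hom functor of $Xx$, $Xe_f$ is the action of $Xf$ on homs, and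 $\mu_{e_x,u}$, $\mu_{u,e_{x'}}$ are identities at $Xu$. Horizontal transformations $F\colon X\Rightarrow Y$: functors $F_x\colon Xx\to Yx$ and natural transformations $F_u\colon Xu\Rightarrow Yu(F_x^{\mathrm{op}}\times F_{x'})$ such that $F_x\circ Xf=Yf\circ F_y$ for $f\colon x\to y$; $F_u(Xf^{\mathrm{op}}\times Xf')\circ X\alpha=Y\alpha(F_y^{\mathrm{op}}\times F_{y'})\circ F_v$ for each square $\alpha\colon[u\,{}^{f}_{f'}\,v]$; $F_{u'\bullet u}\circ\mu_{u,u'}=\mu_{u,u'}(F_x^{\mathrm{op}}\times F_{x''})\circ(F_{u'}\bullet F_u)$; and $F_{e_x}$ is the action of $F_x$ on homs. **Representables.** $\mathbb{C}(-,\hat x)\colon\mathbb{C}^{\mathrm{op}}\to\mathbb{C}\mathrm{at}$ sends $x$ to the category $\mathbb{C}(x,\hat x)$ of horizontal morphisms $g\colon x\to\hat x$ and squares $[e_x\,{}^{g}_{g'}\,e_{\hat x}]$ under vertical composition; $f\colon x\to y$ to precomposition with $f$ and $e_f$; $u\colon x\nrightarrow x'$ to the profunctor with $\mathbb{C}(u,\hat x)(g,g')$ the set of squares $[u\,{}^{g}_{g'}\,e_{\hat x}]$, acted on by vertical composition; a square $\alpha$ to $\eta\mapsto\eta\circ\alpha$; and $\mu_{u,u'}$ is $[\alpha',\alpha]\mapsto\alpha'\bullet\alpha$. A lax double presheaf $X$ is represented by an object $\hat x$ of $\mathbb{C}$ if it is isomorphic to $\mathbb{C}(-,\hat x)$,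 i.e. there is an invertible horizontal transformation $\mathbb{C}(-,\hat x)\Rightarrow X$. **Grothendieck construction.** $\int\!\!\!\int_{\mathbb{C}}X$ is the double category with objects $(x,x_-)$, $x\in\mathbb{C}$, $x_-\in Xx$; horizontal morphisms $(x,x_-)\to(y,y_-)$ the horizontal $f\colon x\to y$ in $\mathbb{C}$ with $x_-=Xf(y_-)$; vertical morphisms $(x,x_-)\nrightarrow(x',x'_-)$ the pairs $(u,u_-)$ with $u\colon x\nrightarrow x'$ and $u_-\in Xu(x_-,x'_-)$; squares $[(u,u_-)\,{}^{f}_{f'}\,(v,v_-)]$ from left objects $(x,x_-),(x',x'_-)$ to right objects $(y,y_-),(y',y'_-)$ the squares $\alpha\colon[u\,{}^{f}_{f'}\,v]$ of $\mathbb{C}$ with $u_-=(X\alpha)_{y_-,y'_-}(v_-)$. Compositions and identities of horizontal morphisms and squares are those of $\mathbb{C}$; $(u',u'_-)\bullet(u,u_-)=(u'\bullet u,(\mu_{u,u'})_{x_-,x''_-}([u'_-,u_-]))$; vertical identities are $(e_x,1_{x_-})$. **Double terminal objects.** For an object $\hat e$ of a double category $\mathbb{E}$, the slice $\mathbb{E}/\hat e$ is the double category with objects $(e,g\colon e\to\hat e)$; horizontal morphisms $(e,g)\to(d,h)$ the horizontal $f\colon e\to d$ with $g=h\circ f$; vertical morphisms $(e,g)\nrightarrow(e',g')$ the pairs $(u,\eta)$ with $u\colon e\nrightarrow e'$ and $\eta\colon[u\,{}^{g}_{g'}\,e_{\hat e}]$; squares $[(u,\eta)\,{}^{f}_{f'}\,(v,\theta)]$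 the squares $\alpha\colon[u\,{}^{f}_{f'}\,v]$ with $\eta=\theta\circ\alpha$. The object $\hat e$ is double terminal if the projection $\mathbb{E}/\hat e\to\mathbb{E}$ is an isomorphism of double categories (equivalently: every object $e$ has a unique horizontal morphism $t_e\colon e\to\hat e$, and every vertical $u\colon e\nrightarrow e'$ has a unique square $[u\,{}^{t_e}_{t_{e'}}\,e_{\hat e}]$). *)

theory Defs
  imports Main
begin

section \<open>Categories and functors\<close>

text \<open>Composition is written in the order of application of functions throughout:
  \<open>ccomp A g f\<close> is \<open>g \<circ> f\<close>, for \<open>f : a \<rightarrow> b\<close> and \<open>g : b \<rightarrow> c\<close>. All equations between maps are
  required on carriers only.\<close>

record ('a, 'm) cat =
  cobj :: "'a set"
  carr :: "'m set"
  cdom :: "'m \<Rightarrow> 'a"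
  ccod :: "'m \<Rightarrow> 'a"
  cid :: "'a \<Rightarrow> 'm"
  ccomp :: "'m \<Rightarrow> 'm \<Rightarrow> 'm"

definition chom :: "('a, 'm) cat \<Rightarrow> 'a \<Rightarrow> 'a \<Rightarrow> 'm set" where
  "chom A a b = {f \<in> carr A. cdom A f = a \<and> ccod A f = b}"

locale category =
  fixes A :: "('a, 'm) cat"
  assumes dom_in: "f \<in> carr A \<Longrightarrow> cdom A f \<in> cobj A"
    and cod_in: "f \<in> carr A \<Longrightarrow> ccod A f \<in> cobj A"
    and id_in: "a \<in> cobj A \<Longrightarrow> cid A a \<in> chom A a a"
    and comp_in: "\<lbrakk>f \<in> chom A a b; g \<in> chom A b c\<rbrakk> \<Longrightarrow> ccomp A g f \<in> chom A a c"
    and id_left: "f \<in> chom A a b \<Longrightarrow> ccomp A (cid A b) f = f"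
    and id_right: "f \<in> chom A a b \<Longrightarrow> ccomp A f (cid A a) = f"
    and assoc: "\<lbrakk>f \<in> chom A a b; g \<in> chom A b c; h \<in> chom A c d\<rbrakk>
      \<Longrightarrow> ccomp A h (ccomp A g f) = ccomp A (ccomp A h g) f"

record ('a, 'm, 'b, 'n) ftor =
  fob :: "'a \<Rightarrow> 'b"
  far :: "'m \<Rightarrow> 'n"

locale ftor_between =
  fixes A :: "('a, 'm) cat" and B :: "('b, 'n) cat" and F :: "('a, 'm, 'b, 'n) ftor"
  assumes ob_in: "a \<in> cobj A \<Longrightarrow> fob F a \<in> cobj B"
    and ar_in: "f \<in> chom A a b \<Longrightarrow> far F f \<in> chom B (fob F a) (fob F b)"
    and pres_id: "a \<in> cobj A \<Longrightarrow> far F (cid A a) = cid B (fob F a)"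
    and pres_comp: "\<lbrakk>f \<in> chom A a b; g \<in> chom A b c\<rbrakk>
      \<Longrightarrow> far F (ccomp A g f) = ccomp B (far F g) (far F f)"


section \<open>Profunctors\<close>

text \<open>A profunctor \<open>U : A\<^sup>o\<^sup>p \<times> B \<rightarrow> Set\<close> has value sets \<open>pel U a b\<close>, and \<open>pact U f g\<close> is the
  function \<open>U(f, g) : U(a, b) \<rightarrow> U(a', b')\<close> for \<open>f : a' \<rightarrow> a\<close> in \<open>A\<close> and \<open>g : b \<rightarrow> b'\<close> in \<open>B\<close>.
  Different value sets need not be disjoint.\<close>

record ('a, 'm, 'b, 'n, 'e) prof =
  pel :: "'a \<Rightarrow> 'b \<Rightarrow> 'e set"
  pact :: "'m \<Rightarrow> 'n \<Rightarrow> 'e \<Rightarrow> 'e"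

locale profunctor =
  fixes A :: "('a, 'm) cat" and B :: "('b, 'n) cat" and U :: "('a, 'm, 'b, 'n, 'e) prof"
  assumes act_in: "\<lbrakk>f \<in> chom A a' a; g \<in> chom B b b'; s \<in> pel U a b\<rbrakk>
      \<Longrightarrow> pact U f g s \<in> pel U a' b'"
    and act_id: "\<lbrakk>a \<in> cobj A; b \<in> cobj B; s \<in> pel U a b\<rbrakk>
      \<Longrightarrow> pact U (cid A a) (cid B b) s = s"
    and act_comp: "\<lbrakk>f \<in> chom A a' a; f' \<in> chom A a'' a'; g \<in> chom B b b'; g' \<in> chom B b' b'';
        s \<in> pel U a b\<rbrakk>
      \<Longrightarrow> pact U (ccomp A f f') (ccomp B g' g) s = pact U f' g' (pact U f g s)"

definition hom_prof :: "('a, 'm) cat \<Rightarrow> ('a, 'm, 'a, 'm, 'm) prof" where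
  "hom_prof A = \<lparr>pel = chom A, pact = (\<lambda>f g s. ccomp A g (ccomp A s f))\<rparr>"

definition prof_eq ::
  "('a, 'm) cat \<Rightarrow> ('b, 'n) cat \<Rightarrow> ('a, 'm, 'b, 'n, 'e) prof \<Rightarrow> ('a, 'm, 'b, 'n, 'e) prof \<Rightarrow> bool"
  where
  "prof_eq A B U V \<longleftrightarrow>
    (\<forall>a\<in>cobj A. \<forall>b\<in>cobj B. pel U a b = pel V a b) \<and>
    (\<forall>a\<in>cobj A. \<forall>a'\<in>cobj A. \<forall>b\<in>cobj B. \<forall>b'\<in>cobj B.
      \<forall>f\<in>chom A a' a. \<forall>g\<in>chom B b b'. \<forall>s\<in>pel U a b. pact U f g s = pact V f g s)"

text \<open>\<open>coend_gen A M B U U' a c\<close> generates the equivalence relation on triples \<open>(m, s', s)\<close>,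
  \<open>s' \<in> U'(m, c)\<close>, \<open>s \<in> U(a, m)\<close>, whose quotient is the coend \<open>\<integral>\<^sup>m U'(m, c) \<times> U(a, m)\<close>.
  The class of \<open>(m, s', s)\<close> is written \<open>[s', s]\<close> in comments.\<close>

definition coend_gen ::
  "('a, 'm) cat \<Rightarrow> ('b, 'n) cat \<Rightarrow> ('c, 'l) cat \<Rightarrow> ('a, 'm, 'b, 'n, 'd) prof \<Rightarrow>
   ('b, 'n, 'c, 'l, 'e) prof \<Rightarrow> 'a \<Rightarrow> 'c \<Rightarrow> (('b \<times> 'e \<times> 'd) \<times> ('b \<times> 'e \<times> 'd)) set" where
  "coend_gen A M B U U' a c =
    {((m, pact U' k (cid B c) t, s), (m', t, pact U (cid A a) k s)) | m m' k s t.
      k \<in> chom M m m' \<and> s \<in> pel U a m \<and> t \<in> pel U' m' c}"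

definition coend_rel ::
  "('a, 'm) cat \<Rightarrow> ('b, 'n) cat \<Rightarrow> ('c, 'l) cat \<Rightarrow> ('a, 'm, 'b, 'n, 'd) prof \<Rightarrow>
   ('b, 'n, 'c, 'l, 'e) prof \<Rightarrow> 'a \<Rightarrow> 'c \<Rightarrow> (('b \<times> 'e \<times> 'd) \<times> ('b \<times> 'e \<times> 'd)) set" where
  "coend_rel A M B U U' a c = (coend_gen A M B U U' a c \<union> (coend_gen A M B U U' a c)\<inverse>)\<^sup>*"

definition coend_class ::
  "('a, 'm) cat \<Rightarrow> ('b, 'n) cat \<Rightarrow> ('c, 'l) cat \<Rightarrow> ('a, 'm, 'b, 'n, 'd) prof \<Rightarrow>
   ('b, 'n, 'c, 'l, 'e) prof \<Rightarrow> 'a \<Rightarrow> 'c \<Rightarrow> 'b \<times> 'e \<times> 'd \<Rightarrow> ('b \<times> 'e \<times> 'd) set" where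
  "coend_class A M B U U' a c t = coend_rel A M B U U' a c `` {t}"

text \<open>The composite \<open>U' \<bullet> U\<close>; the action \<open>[s', s] \<mapsto> [U'(1, g) s', U(f, 1) s]\<close> is the image of a
  class under the action on representatives, saturated.\<close>

definition prof_comp ::
  "('a, 'm) cat \<Rightarrow> ('b, 'n) cat \<Rightarrow> ('c, 'l) cat \<Rightarrow> ('b, 'n, 'c, 'l, 'e) prof \<Rightarrow>
   ('a, 'm, 'b, 'n, 'd) prof \<Rightarrow> ('a, 'm, 'c, 'l, ('b \<times> 'e \<times> 'd) set) prof" where
  "prof_comp A M B U' U =
    \<lparr>pel = (\<lambda>a c. {coend_class A M B U U' a c (m, s', s) | m s' s.
        m \<in> cobj M \<and> s' \<in> pel U' m c \<and> s \<in> pel U a m}),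
     pact = (\<lambda>f g K. coend_rel A M B U U' (cdom A f) (ccod B g) ``
        ((\<lambda>(m, s', s). (m, pact U' (cid M m) g s', pact U f (cid M m) s)) ` K))\<rparr>"

text \<open>Squares of the double category of categories, functors and profunctors: with left boundary
  \<open>U : A \<nrightarrow> A'\<close>, right boundary \<open>V\<close>, top \<open>F\<close> and bottom \<open>F'\<close>, they are the natural transformations
  \<open>U \<Rightarrow> V(F\<^sup>o\<^sup>p \<times> F')\<close>.\<close>

definition prof_square ::
  "('a, 'm) cat \<Rightarrow> ('b, 'n) cat \<Rightarrow> ('a, 'm, 'b, 'n, 'd) prof \<Rightarrow> ('a, 'm, 'c, 'k) ftor \<Rightarrow>
   ('b, 'n, 'c', 'k') ftor \<Rightarrow> ('c, 'k, 'c', 'k', 'e) prof \<Rightarrow> ('a \<Rightarrow> 'b \<Rightarrow> 'd \<Rightarrow> 'e) \<Rightarrow> bool"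
  where
  "prof_square A A' U F F' V \<tau> \<longleftrightarrow>
    (\<forall>a\<in>cobj A. \<forall>a'\<in>cobj A'. \<forall>s\<in>pel U a a'. \<tau> a a' s \<in> pel V (fob F a) (fob F' a')) \<and>
    (\<forall>a\<in>cobj A. \<forall>b\<in>cobj A. \<forall>a'\<in>cobj A'. \<forall>b'\<in>cobj A'.
      \<forall>f\<in>chom A b a. \<forall>g\<in>chom A' a' b'. \<forall>s\<in>pel U a a'.
        \<tau> b b' (pact U f g s) = pact V (far F f) (far F' g) (\<tau> a a' s))"

definition id_ftor :: "('a, 'm, 'a, 'm) ftor" where
  "id_ftor = \<lparr>fob = (\<lambda>a. a), far = (\<lambda>f. f)\<rparr>"


section \<open>Double categories\<close>

text \<open>A square \<open>\<alpha>\<close> has left and right boundary \<open>sleft\<close>, \<open>sright\<close> (vertical morphisms) and top and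
  bottom \<open>stop\<close>, \<open>sbot\<close> (horizontal morphisms). \<open>hcomp C g f = g \<circ> f\<close>, \<open>vcomp C u' u = u' \<bullet> u\<close>,
  \<open>sqh C \<beta> \<alpha> = \<beta> \<circ> \<alpha>\<close>, \<open>sqv C \<alpha>' \<alpha> = \<alpha>' \<bullet> \<alpha>\<close>; the identities are \<open>hid C x = 1\<^sub>x\<close>, \<open>vid C x = e\<^sub>x\<close>,
  \<open>sqhid C u = 1\<^sub>u\<close>, \<open>sqvid C f = e\<^sub>f\<close>.\<close>

record ('o, 'h, 'v, 's) dcat =
  dobj :: "'o set"
  hor :: "'h set"
  hdom :: "'h \<Rightarrow> 'o"
  hcod :: "'h \<Rightarrow> 'o"
  hid :: "'o \<Rightarrow> 'h"
  hcomp :: "'h \<Rightarrow> 'h \<Rightarrow> 'h"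
  ver :: "'v set"
  vdom :: "'v \<Rightarrow> 'o"
  vcod :: "'v \<Rightarrow> 'o"
  vid :: "'o \<Rightarrow> 'v"
  vcomp :: "'v \<Rightarrow> 'v \<Rightarrow> 'v"
  sq :: "'s set"
  sleft :: "'s \<Rightarrow> 'v"
  sright :: "'s \<Rightarrow> 'v"
  stop :: "'s \<Rightarrow> 'h"
  sbot :: "'s \<Rightarrow> 'h"
  sqhid :: "'v \<Rightarrow> 's"
  sqh :: "'s \<Rightarrow> 's \<Rightarrow> 's"
  sqvid :: "'h \<Rightarrow> 's"
  sqv :: "'s \<Rightarrow> 's \<Rightarrow> 's"

definition squares :: "('o, 'h, 'v, 's) dcat \<Rightarrow> 'v \<Rightarrow> 'h \<Rightarrow> 'h \<Rightarrow> 'v \<Rightarrow> 's set" where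
  "squares C u f f' v =
    {\<alpha> \<in> sq C. sleft C \<alpha> = u \<and> stop C \<alpha> = f \<and> sbot C \<alpha> = f' \<and> sright C \<alpha> = v}"

definition hor_cat :: "('o, 'h, 'v, 's) dcat \<Rightarrow> ('o, 'h) cat" where
  "hor_cat C = \<lparr>cobj = dobj C, carr = hor C, cdom = hdom C, ccod = hcod C,
    cid = hid C, ccomp = hcomp C\<rparr>"

definition ver_cat :: "('o, 'h, 'v, 's) dcat \<Rightarrow> ('o, 'v) cat" where
  "ver_cat C = \<lparr>cobj = dobj C, carr = ver C, cdom = vdom C, ccod = vcod C,
    cid = vid C, ccomp = vcomp C\<rparr>"

definition hsq_cat :: "('o, 'h, 'v, 's) dcat \<Rightarrow> ('v, 's) cat" where
  "hsq_cat C = \<lparr>cobj = ver C, carr = sq C, cdom = sleft C, ccod = sright C,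
    cid = sqhid C, ccomp = sqh C\<rparr>"

definition vsq_cat :: "('o, 'h, 'v, 's) dcat \<Rightarrow> ('h, 's) cat" where
  "vsq_cat C = \<lparr>cobj = hor C, carr = sq C, cdom = stop C, ccod = sbot C,
    cid = sqvid C, ccomp = sqv C\<rparr>"

locale double_category =
  fixes C :: "('o, 'h, 'v, 's) dcat"
  assumes hor_category: "category (hor_cat C)"
    and ver_category: "category (ver_cat C)"
    and hsq_category: "category (hsq_cat C)"
    and vsq_category: "category (vsq_cat C)"
    and corner_nw: "\<alpha> \<in> sq C \<Longrightarrow> hdom C (stop C \<alpha>) = vdom C (sleft C \<alpha>)"
    and corner_ne: "\<alpha> \<in> sq C \<Longrightarrow> hcod C (stop C \<alpha>) = vdom C (sright C \<alpha>)"
    and corner_sw: "\<alpha> \<in> sq C \<Longrightarrow> hdom C (sbot C \<alpha>) = vcod C (sleft C \<alpha>)"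
    and corner_se: "\<alpha> \<in> sq C \<Longrightarrow> hcod C (sbot C \<alpha>) = vcod C (sright C \<alpha>)"
    and stop_sqh: "\<lbrakk>\<alpha> \<in> sq C; \<beta> \<in> sq C; sright C \<alpha> = sleft C \<beta>\<rbrakk>
      \<Longrightarrow> stop C (sqh C \<beta> \<alpha>) = hcomp C (stop C \<beta>) (stop C \<alpha>)"
    and sbot_sqh: "\<lbrakk>\<alpha> \<in> sq C; \<beta> \<in> sq C; sright C \<alpha> = sleft C \<beta>\<rbrakk>
      \<Longrightarrow> sbot C (sqh C \<beta> \<alpha>) = hcomp C (sbot C \<beta>) (sbot C \<alpha>)"
    and sleft_sqv: "\<lbrakk>\<alpha> \<in> sq C; \<alpha>' \<in> sq C; sbot C \<alpha> = stop C \<alpha>'\<rbrakk>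
      \<Longrightarrow> sleft C (sqv C \<alpha>' \<alpha>) = vcomp C (sleft C \<alpha>') (sleft C \<alpha>)"
    and sright_sqv: "\<lbrakk>\<alpha> \<in> sq C; \<alpha>' \<in> sq C; sbot C \<alpha> = stop C \<alpha>'\<rbrakk>
      \<Longrightarrow> sright C (sqv C \<alpha>' \<alpha>) = vcomp C (sright C \<alpha>') (sright C \<alpha>)"
    and stop_sqhid: "u \<in> ver C \<Longrightarrow> stop C (sqhid C u) = hid C (vdom C u)"
    and sbot_sqhid: "u \<in> ver C \<Longrightarrow> sbot C (sqhid C u) = hid C (vcod C u)"
    and sleft_sqvid: "f \<in> hor C \<Longrightarrow> sleft C (sqvid C f) = vid C (hdom C f)"
    and sright_sqvid: "f \<in> hor C \<Longrightarrow> sright C (sqvid C f) = vid C (hcod C f)"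
    and interchange: "\<lbrakk>\<alpha> \<in> sq C; \<beta> \<in> sq C; \<alpha>' \<in> sq C; \<beta>' \<in> sq C;
        sright C \<alpha> = sleft C \<beta>; sright C \<alpha>' = sleft C \<beta>';
        sbot C \<alpha> = stop C \<alpha>'; sbot C \<beta> = stop C \<beta>'\<rbrakk>
      \<Longrightarrow> sqv C (sqh C \<beta>' \<alpha>') (sqh C \<beta> \<alpha>) = sqh C (sqv C \<beta>' \<beta>) (sqv C \<alpha>' \<alpha>)"
    and sqh_sqvid: "\<lbrakk>f \<in> hor C; g \<in> hor C; hcod C f = hdom C g\<rbrakk>
      \<Longrightarrow> sqh C (sqvid C g) (sqvid C f) = sqvid C (hcomp C g f)"
    and sqv_sqhid: "\<lbrakk>u \<in> ver C; u' \<in> ver C; vcod C u = vdom C u'\<rbrakk>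
      \<Longrightarrow> sqv C (sqhid C u') (sqhid C u) = sqhid C (vcomp C u' u)"
    and sqvid_hid: "x \<in> dobj C \<Longrightarrow> sqvid C (hid C x) = sqhid C (vid C x)"

record ('o, 'h, 'v, 's, 'o2, 'h2, 'v2, 's2) dftor =
  dfo :: "'o \<Rightarrow> 'o2"
  dfh :: "'h \<Rightarrow> 'h2"
  dfv :: "'v \<Rightarrow> 'v2"
  dfs :: "'s \<Rightarrow> 's2"

definition double_functor ::
  "('o, 'h, 'v, 's) dcat \<Rightarrow> ('o2, 'h2, 'v2, 's2) dcat \<Rightarrow>
   ('o, 'h, 'v, 's, 'o2, 'h2, 'v2, 's2) dftor \<Rightarrow> bool" where
  "double_functor D E F \<longleftrightarrow>
    ftor_between (hor_cat D) (hor_cat E) \<lparr>fob = dfo F, far = dfh F\<rparr> \<and>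
    ftor_between (ver_cat D) (ver_cat E) \<lparr>fob = dfo F, far = dfv F\<rparr> \<and>
    ftor_between (hsq_cat D) (hsq_cat E) \<lparr>fob = dfv F, far = dfs F\<rparr> \<and>
    ftor_between (vsq_cat D) (vsq_cat E) \<lparr>fob = dfh F, far = dfs F\<rparr>"

definition double_iso ::
  "('o, 'h, 'v, 's) dcat \<Rightarrow> ('o2, 'h2, 'v2, 's2) dcat \<Rightarrow>
   ('o, 'h, 'v, 's, 'o2, 'h2, 'v2, 's2) dftor \<Rightarrow> bool" where
  "double_iso D E F \<longleftrightarrow> double_functor D E F \<and>
    (\<exists>G :: ('o2, 'h2, 'v2, 's2, 'o, 'h, 'v, 's) dftor. double_functor E D G \<and>
      (\<forall>x\<in>dobj D. dfo G (dfo F x) = x) \<and> (\<forall>f\<in>hor D. dfh G (dfh F f) = f) \<and>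
      (\<forall>u\<in>ver D. dfv G (dfv F u) = u) \<and> (\<forall>\<alpha>\<in>sq D. dfs G (dfs F \<alpha>) = \<alpha>) \<and>
      (\<forall>x\<in>dobj E. dfo F (dfo G x) = x) \<and> (\<forall>f\<in>hor E. dfh F (dfh G f) = f) \<and>
      (\<forall>u\<in>ver E. dfv F (dfv G u) = u) \<and> (\<forall>\<alpha>\<in>sq E. dfs F (dfs G \<alpha>) = \<alpha>))"


section \<open>Double terminal objects\<close>

text \<open>In the slice, horizontal morphisms and squares carry their source and target, since these
  are not determined by the underlying horizontal morphism or square. A vertical morphism
  \<open>(u, \<eta>)\<close> goes from the object with structure map \<open>stop E \<eta>\<close> to the one with structure map
  \<open>sbot E \<eta>\<close>.\<close>

definition slice ::
  "('o, 'h, 'v, 's) dcat \<Rightarrow> 'o \<Rightarrow>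
   ('o \<times> 'h, ('o \<times> 'h) \<times> 'h \<times> ('o \<times> 'h), 'v \<times> 's, ('v \<times> 's) \<times> 's \<times> ('v \<times> 's)) dcat" where
  "slice E z =
    (let Ob = {(e, g). e \<in> dobj E \<and> g \<in> chom (hor_cat E) e z};
         Ver = {(u, \<eta>). u \<in> ver E \<and> \<eta> \<in> sq E \<and> sleft E \<eta> = u \<and> sright E \<eta> = vid E z};
         src = (\<lambda>(u, \<eta>). (vdom E u, stop E \<eta>));
         trg = (\<lambda>(u, \<eta>). (vcod E u, sbot E \<eta>))
     in
    \<lparr>dobj = Ob,
     hor = {((e, g), f, (d, h)). (e, g) \<in> Ob \<and> (d, h) \<in> Ob \<and>
        f \<in> chom (hor_cat E) e d \<and> g = hcomp E h f},
     hdom = (\<lambda>(p, f, q). p),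
     hcod = (\<lambda>(p, f, q). q),
     hid = (\<lambda>p. (p, hid E (fst p), p)),
     hcomp = (\<lambda>(q', f', r) (p, f, q). (p, hcomp E f' f, r)),
     ver = Ver,
     vdom = src,
     vcod = trg,
     vid = (\<lambda>(e, g). (vid E e, sqvid E g)),
     vcomp = (\<lambda>(u', \<eta>') (u, \<eta>). (vcomp E u' u, sqv E \<eta>' \<eta>)),
     sq = {((u, \<eta>), \<alpha>, (v, \<theta>)). (u, \<eta>) \<in> Ver \<and> (v, \<theta>) \<in> Ver \<and>
        \<alpha> \<in> sq E \<and> sleft E \<alpha> = u \<and> sright E \<alpha> = v \<and> \<eta> = sqh E \<theta> \<alpha>},
     sleft = (\<lambda>(p, \<alpha>, q). p),
     sright = (\<lambda>(p, \<alpha>, q). q),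
     stop = (\<lambda>(p, \<alpha>, q). (src p, stop E \<alpha>, src q)),
     sbot = (\<lambda>(p, \<alpha>, q). (trg p, sbot E \<alpha>, trg q)),
     sqhid = (\<lambda>p. (p, sqhid E (fst p), p)),
     sqh = (\<lambda>(q', \<beta>, r) (p, \<alpha>, q). (p, sqh E \<beta> \<alpha>, r)),
     sqvid = (\<lambda>((e, g), f, (d, h)).
        ((vid E e, sqvid E g), sqvid E f, (vid E d, sqvid E h))),
     sqv = (\<lambda>((u', \<eta>'), \<alpha>', (v', \<theta>')) ((u, \<eta>), \<alpha>, (v, \<theta>)).
        ((vcomp E u' u, sqv E \<eta>' \<eta>), sqv E \<alpha>' \<alpha>, (vcomp E v' v, sqv E \<theta>' \<theta>)))\<rparr>)"

definition slice_proj ::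
  "('o \<times> 'h, ('o \<times> 'h) \<times> 'h \<times> ('o \<times> 'h), 'v \<times> 's, ('v \<times> 's) \<times> 's \<times> ('v \<times> 's),
    'o, 'h, 'v, 's) dftor" where
  "slice_proj = \<lparr>dfo = fst, dfh = (\<lambda>(p, f, q). f), dfv = fst, dfs = (\<lambda>(p, \<alpha>, q). \<alpha>)\<rparr>"

definition double_terminal :: "('o, 'h, 'v, 's) dcat \<Rightarrow> 'o \<Rightarrow> bool" where
  "double_terminal E z \<longleftrightarrow> z \<in> dobj E \<and> double_iso (slice E z) E slice_proj"


section \<open>Lax double presheaves\<close>

text \<open>The type of elements of the profunctors \<open>Xu\<close> is the type of arrows of the categories
  \<open>Xx\<close>, because normality asks \<open>Xe\<^sub>x\<close> to be the hom functor of \<open>Xx\<close>.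
  \<open>pmu X u u' a c\<close> is the component of \<open>\<mu>\<^sub>u\<^sub>,\<^sub>u'\<close> at \<open>(a, c)\<close>, a map from
  \<open>(Xu' \<bullet> Xu)(a, c)\<close> to \<open>X(u' \<bullet> u)(a, c)\<close>.\<close>

record ('o, 'h, 'v, 's, 'a, 'm) presheaf =
  pobj :: "'o \<Rightarrow> ('a, 'm) cat"
  phor :: "'h \<Rightarrow> ('a, 'm, 'a, 'm) ftor"
  pver :: "'v \<Rightarrow> ('a, 'm, 'a, 'm, 'm) prof"
  psq :: "'s \<Rightarrow> 'a \<Rightarrow> 'a \<Rightarrow> 'm \<Rightarrow> 'm"
  pmu :: "'v \<Rightarrow> 'v \<Rightarrow> 'a \<Rightarrow> 'a \<Rightarrow> ('a \<times> 'm \<times> 'm) set \<Rightarrow> 'm"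

text \<open>\<open>mu_at C X u u' a c b s' s\<close> is \<open>(\<mu>\<^sub>u\<^sub>,\<^sub>u')\<^sub>a\<^sub>,\<^sub>c [s', s]\<close>, for \<open>s' \<in> Xu'(b, c)\<close> and
  \<open>s \<in> Xu(a, b)\<close>.\<close>

definition mu_at ::
  "('o, 'h, 'v, 's) dcat \<Rightarrow> ('o, 'h, 'v, 's, 'a, 'm) presheaf \<Rightarrow>
   'v \<Rightarrow> 'v \<Rightarrow> 'a \<Rightarrow> 'a \<Rightarrow> 'a \<Rightarrow> 'm \<Rightarrow> 'm \<Rightarrow> 'm" where
  "mu_at C X u u' a c b s' s = pmu X u u' a c
    (coend_class (pobj X (vdom C u)) (pobj X (vcod C u)) (pobj X (vcod C u'))
      (pver X u) (pver X u') a c (b, s', s))"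

text \<open>In \<open>mu_unit_left\<close> and \<open>mu_unit_right\<close>, the identification of \<open>U \<bullet> e\<close> and \<open>e \<bullet> U\<close> with \<open>U\<close>
  is the co-Yoneda isomorphism \<open>[s, f] \<mapsto> U(f, 1) s\<close>, respectively \<open>[g, s] \<mapsto> U(1, g) s\<close>.
  \<open>mu_natural\<close> and \<open>mu_assoc\<close> are stated on representatives; every element of a composite of
  profunctors is the class of one.\<close>

locale lax_double_presheaf =
  fixes C :: "('o, 'h, 'v, 's) dcat" and X :: "('o, 'h, 'v, 's, 'a, 'm) presheaf"
  assumes obj_category: "x \<in> dobj C \<Longrightarrow> category (pobj X x)"
    and hor_ftor: "f \<in> hor C
      \<Longrightarrow> ftor_between (pobj X (hcod C f)) (pobj X (hdom C f)) (phor X f)"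
    and ver_prof: "u \<in> ver C
      \<Longrightarrow> profunctor (pobj X (vdom C u)) (pobj X (vcod C u)) (pver X u)"
    and sq_nat: "\<alpha> \<in> squares C u f f' v
      \<Longrightarrow> prof_square (pobj X (hcod C f)) (pobj X (hcod C f'))
            (pver X v) (phor X f) (phor X f') (pver X u) (psq X \<alpha>)"
    and mu_nat: "\<lbrakk>u \<in> ver C; u' \<in> ver C; vcod C u = vdom C u'\<rbrakk>
      \<Longrightarrow> prof_square (pobj X (vdom C u)) (pobj X (vcod C u'))
            (prof_comp (pobj X (vdom C u)) (pobj X (vcod C u)) (pobj X (vcod C u'))
              (pver X u') (pver X u))
            id_ftor id_ftor (pver X (vcomp C u' u)) (pmu X u u')"
    \<comment> \<open>strict preservation of horizontal identities and compositions\<close>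
    and hid_ob: "\<lbrakk>x \<in> dobj C; a \<in> cobj (pobj X x)\<rbrakk> \<Longrightarrow> fob (phor X (hid C x)) a = a"
    and hid_ar: "\<lbrakk>x \<in> dobj C; k \<in> carr (pobj X x)\<rbrakk> \<Longrightarrow> far (phor X (hid C x)) k = k"
    and hcomp_ob: "\<lbrakk>f \<in> hor C; g \<in> hor C; hcod C f = hdom C g; a \<in> cobj (pobj X (hcod C g))\<rbrakk>
      \<Longrightarrow> fob (phor X (hcomp C g f)) a = fob (phor X f) (fob (phor X g) a)"
    and hcomp_ar: "\<lbrakk>f \<in> hor C; g \<in> hor C; hcod C f = hdom C g; k \<in> carr (pobj X (hcod C g))\<rbrakk>
      \<Longrightarrow> far (phor X (hcomp C g f)) k = far (phor X f) (far (phor X g) k)"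
    and sqhid_eq: "\<lbrakk>u \<in> ver C; a \<in> cobj (pobj X (vdom C u)); a' \<in> cobj (pobj X (vcod C u));
        s \<in> pel (pver X u) a a'\<rbrakk>
      \<Longrightarrow> psq X (sqhid C u) a a' s = s"
    and sqh_eq: "\<lbrakk>\<alpha> \<in> squares C u f f' v; \<beta> \<in> squares C v g g' w;
        a \<in> cobj (pobj X (hcod C g)); a' \<in> cobj (pobj X (hcod C g')); s \<in> pel (pver X w) a a'\<rbrakk>
      \<Longrightarrow> psq X (sqh C \<beta> \<alpha>) a a' s =
          psq X \<alpha> (fob (phor X g) a) (fob (phor X g') a') (psq X \<beta> a a' s)"
    \<comment> \<open>naturality and associativity of \<open>\<mu>\<close>\<close>
    and mu_natural: "\<lbrakk>\<alpha> \<in> squares C u f f' v; \<alpha>' \<in> squares C u' f' f'' v';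
        a \<in> cobj (pobj X (hcod C f)); b \<in> cobj (pobj X (hcod C f'));
        c \<in> cobj (pobj X (hcod C f'')); s \<in> pel (pver X v) a b; s' \<in> pel (pver X v') b c\<rbrakk>
      \<Longrightarrow> psq X (sqv C \<alpha>' \<alpha>) a c (mu_at C X v v' a c b s' s) =
          mu_at C X u u' (fob (phor X f) a) (fob (phor X f'') c) (fob (phor X f') b)
            (psq X \<alpha>' b c s') (psq X \<alpha> a b s)"
    and mu_assoc: "\<lbrakk>u \<in> ver C; u' \<in> ver C; u'' \<in> ver C;
        vcod C u = vdom C u'; vcod C u' = vdom C u'';
        a \<in> cobj (pobj X (vdom C u)); b \<in> cobj (pobj X (vcod C u));
        c \<in> cobj (pobj X (vcod C u')); d \<in> cobj (pobj X (vcod C u''));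
        s \<in> pel (pver X u) a b; s' \<in> pel (pver X u') b c; s'' \<in> pel (pver X u'') c d\<rbrakk>
      \<Longrightarrow> mu_at C X u (vcomp C u'' u') a d b (mu_at C X u' u'' b d c s'' s') s =
          mu_at C X (vcomp C u' u) u'' a d c s'' (mu_at C X u u' a c b s' s)"
    \<comment> \<open>normality\<close>
    and vid_hom: "x \<in> dobj C
      \<Longrightarrow> prof_eq (pobj X x) (pobj X x) (pver X (vid C x)) (hom_prof (pobj X x))"
    and sqvid_act: "\<lbrakk>f \<in> hor C; k \<in> chom (pobj X (hcod C f)) a b\<rbrakk>
      \<Longrightarrow> psq X (sqvid C f) a b k = far (phor X f) k"
    and mu_unit_left: "\<lbrakk>u \<in> ver C; k \<in> chom (pobj X (vdom C u)) a b;
        c \<in> cobj (pobj X (vcod C u)); s \<in> pel (pver X u) b c\<rbrakk>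
      \<Longrightarrow> mu_at C X (vid C (vdom C u)) u a c b s k =
          pact (pver X u) k (cid (pobj X (vcod C u)) c) s"
    and mu_unit_right: "\<lbrakk>u \<in> ver C; a \<in> cobj (pobj X (vdom C u));
        k \<in> chom (pobj X (vcod C u)) b c; s \<in> pel (pver X u) a b\<rbrakk>
      \<Longrightarrow> mu_at C X u (vid C (vcod C u)) a c b k s =
          pact (pver X u) (cid (pobj X (vdom C u)) a) k s"


section \<open>Horizontal transformations and isomorphisms\<close>

record ('o, 'v, 'a, 'm, 'b, 'n) htrans =
  tob :: "'o \<Rightarrow> ('a, 'm, 'b, 'n) ftor"
  tver :: "'v \<Rightarrow> 'a \<Rightarrow> 'a \<Rightarrow> 'm \<Rightarrow> 'n"

locale horizontal_transformation =
  fixes C :: "('o, 'h, 'v, 's) dcat"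
    and X :: "('o, 'h, 'v, 's, 'a, 'm) presheaf" and Y :: "('o, 'h, 'v, 's, 'b, 'n) presheaf"
    and F :: "('o, 'v, 'a, 'm, 'b, 'n) htrans"
  assumes ob_ftor: "x \<in> dobj C \<Longrightarrow> ftor_between (pobj X x) (pobj Y x) (tob F x)"
    and ver_nat: "u \<in> ver C
      \<Longrightarrow> prof_square (pobj X (vdom C u)) (pobj X (vcod C u)) (pver X u)
            (tob F (vdom C u)) (tob F (vcod C u)) (pver Y u) (tver F u)"
    and hor_ob: "\<lbrakk>f \<in> hor C; a \<in> cobj (pobj X (hcod C f))\<rbrakk>
      \<Longrightarrow> fob (tob F (hdom C f)) (fob (phor X f) a) = fob (phor Y f) (fob (tob F (hcod C f)) a)"
    and hor_ar: "\<lbrakk>f \<in> hor C; k \<in> carr (pobj X (hcod C f))\<rbrakk>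
      \<Longrightarrow> far (tob F (hdom C f)) (far (phor X f) k) = far (phor Y f) (far (tob F (hcod C f)) k)"
    and sq_natural: "\<lbrakk>\<alpha> \<in> squares C u f f' v; a \<in> cobj (pobj X (hcod C f));
        a' \<in> cobj (pobj X (hcod C f')); s \<in> pel (pver X v) a a'\<rbrakk>
      \<Longrightarrow> tver F u (fob (phor X f) a) (fob (phor X f') a') (psq X \<alpha> a a' s) =
          psq Y \<alpha> (fob (tob F (hcod C f)) a) (fob (tob F (hcod C f')) a') (tver F v a a' s)"
    and mu_comp: "\<lbrakk>u \<in> ver C; u' \<in> ver C; vcod C u = vdom C u';
        a \<in> cobj (pobj X (vdom C u)); b \<in> cobj (pobj X (vcod C u));
        c \<in> cobj (pobj X (vcod C u')); s \<in> pel (pver X u) a b; s' \<in> pel (pver X u') b c\<rbrakk>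
      \<Longrightarrow> tver F (vcomp C u' u) a c (mu_at C X u u' a c b s' s) =
          mu_at C Y u u' (fob (tob F (vdom C u)) a) (fob (tob F (vcod C u')) c)
            (fob (tob F (vcod C u)) b) (tver F u' b c s') (tver F u a b s)"
    and vid_act: "\<lbrakk>x \<in> dobj C; k \<in> chom (pobj X x) a b\<rbrakk>
      \<Longrightarrow> tver F (vid C x) a b k = far (tob F x) k"

definition htrans_comp ::
  "('o, 'h, 'v, 's) dcat \<Rightarrow> ('o, 'v, 'b, 'n, 'c, 'l) htrans \<Rightarrow>
   ('o, 'v, 'a, 'm, 'b, 'n) htrans \<Rightarrow> ('o, 'v, 'a, 'm, 'c, 'l) htrans" where
  "htrans_comp C G F =
    \<lparr>tob = (\<lambda>x. \<lparr>fob = fob (tob G x) \<circ> fob (tob F x), far = far (tob G x) \<circ> far (tob F x)\<rparr>),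
     tver = (\<lambda>u a a' s. tver G u (fob (tob F (vdom C u)) a) (fob (tob F (vcod C u)) a')
        (tver F u a a' s))\<rparr>"

definition is_id_htrans ::
  "('o, 'h, 'v, 's) dcat \<Rightarrow> ('o, 'h, 'v, 's, 'a, 'm) presheaf \<Rightarrow>
   ('o, 'v, 'a, 'm, 'a, 'm) htrans \<Rightarrow> bool" where
  "is_id_htrans C X F \<longleftrightarrow>
    (\<forall>x\<in>dobj C. (\<forall>a\<in>cobj (pobj X x). fob (tob F x) a = a) \<and>
      (\<forall>k\<in>carr (pobj X x). far (tob F x) k = k)) \<and>
    (\<forall>u\<in>ver C. \<forall>a\<in>cobj (pobj X (vdom C u)). \<forall>a'\<in>cobj (pobj X (vcod C u)).
      \<forall>s\<in>pel (pver X u) a a'. tver F u a a' s = s)"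

definition presheaf_iso ::
  "('o, 'h, 'v, 's) dcat \<Rightarrow> ('o, 'h, 'v, 's, 'a, 'm) presheaf \<Rightarrow>
   ('o, 'h, 'v, 's, 'b, 'n) presheaf \<Rightarrow> bool" where
  "presheaf_iso C X Y \<longleftrightarrow>
    (\<exists>(F :: ('o, 'v, 'a, 'm, 'b, 'n) htrans) (G :: ('o, 'v, 'b, 'n, 'a, 'm) htrans).
      horizontal_transformation C X Y F \<and> horizontal_transformation C Y X G \<and>
      is_id_htrans C X (htrans_comp C G F) \<and> is_id_htrans C Y (htrans_comp C F G))"


section \<open>Representables\<close>

text \<open>The component of \<open>\<mu>\<close> is the common value of \<open>\<alpha>' \<bullet> \<alpha>\<close> on the representatives of a class.\<close>

definition representable ::
  "('o, 'h, 'v, 's) dcat \<Rightarrow> 'o \<Rightarrow> ('o, 'h, 'v, 's, 'h, 's) presheaf" where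
  "representable C z =
    \<lparr>pobj = (\<lambda>x. \<lparr>cobj = chom (hor_cat C) x z,
        carr = {\<eta> \<in> sq C. sleft C \<eta> = vid C x \<and> sright C \<eta> = vid C z},
        cdom = stop C, ccod = sbot C, cid = sqvid C, ccomp = sqv C\<rparr>),
     phor = (\<lambda>f. \<lparr>fob = (\<lambda>g. hcomp C g f), far = (\<lambda>\<eta>. sqh C \<eta> (sqvid C f))\<rparr>),
     pver = (\<lambda>u. \<lparr>pel = (\<lambda>g g'. squares C u g g' (vid C z)),
        pact = (\<lambda>\<beta> \<beta>' \<eta>. sqv C \<beta>' (sqv C \<eta> \<beta>))\<rparr>),
     psq = (\<lambda>\<alpha> g g' \<eta>. sqh C \<eta> \<alpha>),
     pmu = (\<lambda>u u' g g'' K. the_elem ((\<lambda>(g', \<alpha>', \<alpha>). sqv C \<alpha>' \<alpha>) ` K))\<rparr>"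

definition represented_by ::
  "('o, 'h, 'v, 's) dcat \<Rightarrow> ('o, 'h, 'v, 's, 'a, 'm) presheaf \<Rightarrow> 'o \<Rightarrow> bool" where
  "represented_by C X z \<longleftrightarrow> z \<in> dobj C \<and> presheaf_iso C (representable C z) X"


section \<open>The Grothendieck construction\<close>

text \<open>As sets \<open>Xu(a, a')\<close> for different \<open>a\<close>, \<open>a'\<close> may overlap, morphisms and squares carry their
  sources and targets: a horizontal morphism \<open>f : (x, a) \<rightarrow> (y, b)\<close> is encoded as \<open>(a, f, b)\<close>, a
  vertical morphism \<open>(u, p) : (x, a) \<nrightarrow> (x', a')\<close> as \<open>(a, u, p, a')\<close>, and a square as \<open>(U, \<alpha>, V)\<close>
  with \<open>U\<close> and \<open>V\<close> its left and right boundary.\<close>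

definition groth ::
  "('o, 'h, 'v, 's) dcat \<Rightarrow> ('o, 'h, 'v, 's, 'a, 'm) presheaf \<Rightarrow>
   ('o \<times> 'a, 'a \<times> 'h \<times> 'a, 'a \<times> 'v \<times> 'm \<times> 'a,
    ('a \<times> 'v \<times> 'm \<times> 'a) \<times> 's \<times> ('a \<times> 'v \<times> 'm \<times> 'a)) dcat" where
  "groth C X =
    (let Ver = {(a, u, p, a'). u \<in> ver C \<and> a \<in> cobj (pobj X (vdom C u)) \<and>
           a' \<in> cobj (pobj X (vcod C u)) \<and> p \<in> pel (pver X u) a a'};
         vident = (\<lambda>(x, a). (a, vid C x, cid (pobj X x) a, a));
         vcompo = (\<lambda>(b', u', p', c) (a, u, p, b).
           (a, vcomp C u' u, mu_at C X u u' a c b p' p, c))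
     in
    \<lparr>dobj = {(x, a). x \<in> dobj C \<and> a \<in> cobj (pobj X x)},
     hor = {(a, f, b). f \<in> hor C \<and> a \<in> cobj (pobj X (hdom C f)) \<and>
        b \<in> cobj (pobj X (hcod C f)) \<and> a = fob (phor X f) b},
     hdom = (\<lambda>(a, f, b). (hdom C f, a)),
     hcod = (\<lambda>(a, f, b). (hcod C f, b)),
     hid = (\<lambda>(x, a). (a, hid C x, a)),
     hcomp = (\<lambda>(b', g, c) (a, f, b). (a, hcomp C g f, c)),
     ver = Ver,
     vdom = (\<lambda>(a, u, p, a'). (vdom C u, a)),
     vcod = (\<lambda>(a, u, p, a'). (vcod C u, a')),
     vid = vident,
     vcomp = vcompo,
     sq = {((a, u, p, a'), \<alpha>, (b, v, q, b')). (a, u, p, a') \<in> Ver \<and> (b, v, q, b') \<in> Ver \<and>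
        \<alpha> \<in> sq C \<and> sleft C \<alpha> = u \<and> sright C \<alpha> = v \<and>
        a = fob (phor X (stop C \<alpha>)) b \<and> a' = fob (phor X (sbot C \<alpha>)) b' \<and>
        p = psq X \<alpha> b b' q},
     sleft = (\<lambda>(U, \<alpha>, V). U),
     sright = (\<lambda>(U, \<alpha>, V). V),
     stop = (\<lambda>((a, u, p, a'), \<alpha>, (b, v, q, b')). (a, stop C \<alpha>, b)),
     sbot = (\<lambda>((a, u, p, a'), \<alpha>, (b, v, q, b')). (a', sbot C \<alpha>, b')),
     sqhid = (\<lambda>(a, u, p, a'). ((a, u, p, a'), sqhid C u, (a, u, p, a'))),
     sqh = (\<lambda>(V', \<beta>, W) (U, \<alpha>, V). (U, sqh C \<beta> \<alpha>, W)),
     sqvid = (\<lambda>(a, f, b). (vident (hdom C f, a), sqvid C f, vident (hcod C f, b))),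
     sqv = (\<lambda>(U', \<alpha>', V') (U, \<alpha>, V). (vcompo U' U, sqv C \<alpha>' \<alpha>, vcompo V' V))\<rparr>)"

end

theory Submission
  imports Defs
begin

text \<open>
  The theorem is the double-categorical form of the fact that a presheaf is representable
  precisely if its category of elements has a terminal object, and it is proved through the
  Yoneda correspondence. An element \<open>c\<close> of \<open>Xz\<close> gives a horizontal transformation
  \<open>C(-, z) \<Rightarrow> X\<close> that sends a horizontal \<open>g : x \<rightarrow> z\<close> to \<open>Xg(c)\<close> and a square
  \<open>\<eta> : [u g g' e\<^sub>z]\<close> to \<open>X\<eta>(1\<^sub>c)\<close> (\<open>yoneda_transformation\<close>), and every transformation \<open>F\<close> out of
  \<open>C(-, z)\<close> arises in this way from \<open>c = F\<^sub>z(1\<^sub>z)\<close> (\<open>transformation_eq_yoneda\<close>).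

  A double terminal object is an object to which every object has exactly one horizontal
  morphism, and such that every vertical morphism is the left boundary of exactly one square
  whose right boundary is the vertical identity of that object (\<open>double_terminal_iff_unique\<close>).
  In the Grothendieck construction a horizontal morphism \<open>(x, a) \<rightarrow> (z, c)\<close> is a \<open>g : x \<rightarrow> z\<close> with
  \<open>Xg(c) = a\<close>, and a square from \<open>(u, p)\<close> to the vertical identity of \<open>(z, c)\<close> is a square
  \<open>\<eta> : [u g g' e\<^sub>z]\<close> with \<open>X\<eta>(1\<^sub>c) = p\<close>. Unique existence of these is bijectivity of
  the transformation given by \<open>c\<close>, on objects and on the elements of the profunctors
  (\<open>double_terminal_iff_yoneda_bijective\<close>).

  It remains to see that bijectivity is the same as invertibility. The components of an
  invertible transformation are bijections; conversely, pointwise inverses of a transformation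
  of lax double presheaves form a transformation, because each equation that it
  has to satisfy becomes true after the injective components are applied
  (\<open>inv_transformation\<close>). To use this for \<open>C(-, z)\<close>, one needs that \<open>C(-, z)\<close> is itself a lax
  double presheaf (\<open>rep_lax_double_presheaf\<close>); the criterion for double terminal objects needs that
  the Grothendieck construction is a double category (\<open>groth_double_category\<close>).
\<close>

section \<open>Elementwise forms of the axioms\<close>

lemma chom_iff: "f \<in> chom A a b \<longleftrightarrow> f \<in> carr A \<and> cdom A f = a \<and> ccod A f = b"
  by (auto simp: chom_def)

lemma squares_iff:
  "\<alpha> \<in> squares C u f f' v \<longleftrightarrow>
    \<alpha> \<in> sq C \<and> sleft C \<alpha> = u \<and> stop C \<alpha> = f \<and> sbot C \<alpha> = f' \<and> sright C \<alpha> = v"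
  by (auto simp: squares_def)

context category
begin

lemma id_carr: "a \<in> cobj A \<Longrightarrow> cid A a \<in> carr A"
  and dom_id: "a \<in> cobj A \<Longrightarrow> cdom A (cid A a) = a"
  and cod_id: "a \<in> cobj A \<Longrightarrow> ccod A (cid A a) = a"
  using id_in by (auto simp: chom_iff)

lemma comp_carr: "\<lbrakk>f \<in> carr A; g \<in> carr A; ccod A f = cdom A g\<rbrakk> \<Longrightarrow> ccomp A g f \<in> carr A"
  and dom_comp: "\<lbrakk>f \<in> carr A; g \<in> carr A; ccod A f = cdom A g\<rbrakk> \<Longrightarrow> cdom A (ccomp A g f) = cdom A f"
  and cod_comp: "\<lbrakk>f \<in> carr A; g \<in> carr A; ccod A f = cdom A g\<rbrakk> \<Longrightarrow> ccod A (ccomp A g f) = ccod A g"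
  using comp_in by (auto simp: chom_iff)

lemma comp_id_left: "\<lbrakk>f \<in> carr A; ccod A f = b\<rbrakk> \<Longrightarrow> ccomp A (cid A b) f = f"
  and comp_id_right: "\<lbrakk>f \<in> carr A; cdom A f = a\<rbrakk> \<Longrightarrow> ccomp A f (cid A a) = f"
  using id_left id_right by (auto simp: chom_iff)

lemma comp_assoc:
  "\<lbrakk>f \<in> carr A; g \<in> carr A; h \<in> carr A; ccod A f = cdom A g; ccod A g = cdom A h\<rbrakk>
    \<Longrightarrow> ccomp A h (ccomp A g f) = ccomp A (ccomp A h g) f"
  using assoc by (auto simp: chom_iff)

end

lemma categoryI:
  assumes "\<And>f. f \<in> carr A \<Longrightarrow> cdom A f \<in> cobj A \<and> ccod A f \<in> cobj A"
    and "\<And>a. a \<in> cobj A \<Longrightarrow> cid A a \<in> carr A \<and> cdom A (cid A a) = a \<and> ccod A (cid A a) = a"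
    and "\<And>f g. \<lbrakk>f \<in> carr A; g \<in> carr A; ccod A f = cdom A g\<rbrakk>
      \<Longrightarrow> ccomp A g f \<in> carr A \<and> cdom A (ccomp A g f) = cdom A f \<and> ccod A (ccomp A g f) = ccod A g"
    and "\<And>f. f \<in> carr A \<Longrightarrow> ccomp A (cid A (ccod A f)) f = f \<and> ccomp A f (cid A (cdom A f)) = f"
    and "\<And>f g h. \<lbrakk>f \<in> carr A; g \<in> carr A; h \<in> carr A; ccod A f = cdom A g; ccod A g = cdom A h\<rbrakk>
      \<Longrightarrow> ccomp A h (ccomp A g f) = ccomp A (ccomp A h g) f"
  shows "category A"
  by unfold_locales (use assms in \<open>auto simp: chom_iff\<close>)

lemma ftor_betweenI:
  assumes "\<And>a. a \<in> cobj A \<Longrightarrow> fob F a \<in> cobj B"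
    and "\<And>f. f \<in> carr A \<Longrightarrow>
      far F f \<in> carr B \<and> cdom B (far F f) = fob F (cdom A f) \<and> ccod B (far F f) = fob F (ccod A f)"
    and "\<And>a. a \<in> cobj A \<Longrightarrow> far F (cid A a) = cid B (fob F a)"
    and "\<And>f g. \<lbrakk>f \<in> carr A; g \<in> carr A; ccod A f = cdom A g\<rbrakk>
      \<Longrightarrow> far F (ccomp A g f) = ccomp B (far F g) (far F f)"
  shows "ftor_between A B F"
  by unfold_locales (use assms in \<open>auto simp: chom_iff\<close>)

lemma hor_cat_sel [simp]:
  "cobj (hor_cat C) = dobj C" "carr (hor_cat C) = hor C" "cdom (hor_cat C) = hdom C"
  "ccod (hor_cat C) = hcod C" "cid (hor_cat C) = hid C" "ccomp (hor_cat C) = hcomp C"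
  by (simp_all add: hor_cat_def)

lemma ver_cat_sel [simp]:
  "cobj (ver_cat C) = dobj C" "carr (ver_cat C) = ver C" "cdom (ver_cat C) = vdom C"
  "ccod (ver_cat C) = vcod C" "cid (ver_cat C) = vid C" "ccomp (ver_cat C) = vcomp C"
  by (simp_all add: ver_cat_def)

lemma hsq_cat_sel [simp]:
  "cobj (hsq_cat C) = ver C" "carr (hsq_cat C) = sq C" "cdom (hsq_cat C) = sleft C"
  "ccod (hsq_cat C) = sright C" "cid (hsq_cat C) = sqhid C" "ccomp (hsq_cat C) = sqh C"
  by (simp_all add: hsq_cat_def)

lemma vsq_cat_sel [simp]:
  "cobj (vsq_cat C) = hor C" "carr (vsq_cat C) = sq C" "cdom (vsq_cat C) = stop C"
  "ccod (vsq_cat C) = sbot C" "cid (vsq_cat C) = sqvid C" "ccomp (vsq_cat C) = sqv C"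
  by (simp_all add: vsq_cat_def)

context double_category
begin

sublocale hor: category "hor_cat C" by (rule hor_category)
sublocale ver: category "ver_cat C" by (rule ver_category)
sublocale hsq: category "hsq_cat C" by (rule hsq_category)
sublocale vsq: category "vsq_cat C" by (rule vsq_category)

lemmas hor_facts [simp] =
  hor.dom_in [simplified] hor.cod_in [simplified]
  hor.id_carr [simplified] hor.dom_id [simplified] hor.cod_id [simplified]
  hor.comp_carr [simplified] hor.dom_comp [simplified] hor.cod_comp [simplified]
  hor.comp_id_left [simplified] hor.comp_id_right [simplified]

lemmas ver_facts [simp] =
  ver.dom_in [simplified] ver.cod_in [simplified]
  ver.id_carr [simplified] ver.dom_id [simplified] ver.cod_id [simplified]
  ver.comp_carr [simplified] ver.dom_comp [simplified] ver.cod_comp [simplified]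
  ver.comp_id_left [simplified] ver.comp_id_right [simplified]

lemmas hsq_facts [simp] =
  hsq.dom_in [simplified] hsq.cod_in [simplified]
  hsq.id_carr [simplified] hsq.dom_id [simplified] hsq.cod_id [simplified]
  hsq.comp_carr [simplified] hsq.dom_comp [simplified] hsq.cod_comp [simplified]
  hsq.comp_id_left [simplified] hsq.comp_id_right [simplified]

lemmas vsq_facts [simp] =
  vsq.dom_in [simplified] vsq.cod_in [simplified]
  vsq.id_carr [simplified] vsq.dom_id [simplified] vsq.cod_id [simplified]
  vsq.comp_carr [simplified] vsq.dom_comp [simplified] vsq.cod_comp [simplified]
  vsq.comp_id_left [simplified] vsq.comp_id_right [simplified]

lemmas hcomp_assoc = hor.comp_assoc [simplified]
lemmas vcomp_assoc = ver.comp_assoc [simplified]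
lemmas sqh_assoc = hsq.comp_assoc [simplified]
lemmas sqv_assoc = vsq.comp_assoc [simplified]

text \<open>As rewrite rules, the corner equations express every corner of a square through its vertical
  boundaries.\<close>
lemmas square_facts [simp] =
  corner_nw corner_ne corner_sw corner_se stop_sqh sbot_sqh sleft_sqv sright_sqv
  stop_sqhid sbot_sqhid sleft_sqvid sright_sqvid sqvid_hid

text \<open>The premise is an equation of horizontal morphisms, from which rewriting towards the
  vertical boundaries does not reach the conclusion.\<close>
lemma vertical_sides_composable [simp]:
  assumes "\<alpha> \<in> sq C" "\<beta> \<in> sq C" "sbot C \<alpha> = stop C \<beta>"
  shows "vcod C (sleft C \<alpha>) = vdom C (sleft C \<beta>)" "vcod C (sright C \<alpha>) = vdom C (sright C \<beta>)"
  using assms by (metis corner_nw corner_sw, metis corner_ne corner_se)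

end

section \<open>Double terminal objects by unique existence\<close>

lemma slice_sel:
  "dobj (slice E z) = {(e, g). e \<in> dobj E \<and> g \<in> chom (hor_cat E) e z}"
  "hor (slice E z) = {((e, g), f, (d, h)). e \<in> dobj E \<and> g \<in> chom (hor_cat E) e z \<and>
     d \<in> dobj E \<and> h \<in> chom (hor_cat E) d z \<and> f \<in> chom (hor_cat E) e d \<and> g = hcomp E h f}"
  "hdom (slice E z) = (\<lambda>(p, f, q). p)"
  "hcod (slice E z) = (\<lambda>(p, f, q). q)"
  "hid (slice E z) = (\<lambda>p. (p, hid E (fst p), p))"
  "hcomp (slice E z) = (\<lambda>(q', f', r) (p, f, q). (p, hcomp E f' f, r))"
  "ver (slice E z) = {(u, \<eta>). u \<in> ver E \<and> \<eta> \<in> sq E \<and> sleft E \<eta> = u \<and> sright E \<eta> = vid E z}"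
  "vdom (slice E z) = (\<lambda>(u, \<eta>). (vdom E u, stop E \<eta>))"
  "vcod (slice E z) = (\<lambda>(u, \<eta>). (vcod E u, sbot E \<eta>))"
  "vid (slice E z) = (\<lambda>(e, g). (vid E e, sqvid E g))"
  "vcomp (slice E z) = (\<lambda>(u', \<eta>') (u, \<eta>). (vcomp E u' u, sqv E \<eta>' \<eta>))"
  "sq (slice E z) = {((u, \<eta>), \<alpha>, (v, \<theta>)).
     u \<in> ver E \<and> \<eta> \<in> sq E \<and> sleft E \<eta> = u \<and> sright E \<eta> = vid E z \<and>
     v \<in> ver E \<and> \<theta> \<in> sq E \<and> sleft E \<theta> = v \<and> sright E \<theta> = vid E z \<and>
     \<alpha> \<in> sq E \<and> sleft E \<alpha> = u \<and> sright E \<alpha> = v \<and> \<eta> = sqh E \<theta> \<alpha>}"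
  "sleft (slice E z) = (\<lambda>(p, \<alpha>, q). p)"
  "sright (slice E z) = (\<lambda>(p, \<alpha>, q). q)"
  "stop (slice E z) = (\<lambda>((u, \<eta>), \<alpha>, (v, \<theta>)). ((vdom E u, stop E \<eta>), stop E \<alpha>, (vdom E v, stop E \<theta>)))"
  "sbot (slice E z) = (\<lambda>((u, \<eta>), \<alpha>, (v, \<theta>)). ((vcod E u, sbot E \<eta>), sbot E \<alpha>, (vcod E v, sbot E \<theta>)))"
  "sqhid (slice E z) = (\<lambda>p. (p, sqhid E (fst p), p))"
  "sqh (slice E z) = (\<lambda>(q', \<beta>, r) (p, \<alpha>, q). (p, sqh E \<beta> \<alpha>, r))"
  "sqvid (slice E z) = (\<lambda>((e, g), f, (d, h)). ((vid E e, sqvid E g), sqvid E f, (vid E d, sqvid E h)))"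
  "sqv (slice E z) = (\<lambda>((u', \<eta>'), \<alpha>', (v', \<theta>')) ((u, \<eta>), \<alpha>, (v, \<theta>)).
     ((vcomp E u' u, sqv E \<eta>' \<eta>), sqv E \<alpha>' \<alpha>, (vcomp E v' v, sqv E \<theta>' \<theta>)))"
  by (simp_all add: slice_def Let_def case_prod_beta' conj_assoc)

context double_category
begin

lemma slice_proj_double_functor:
  "double_functor (slice C z) C slice_proj"
  unfolding double_functor_def slice_proj_def
  by (intro conjI; rule ftor_betweenI)
    (simp_all add: slice_sel chom_iff split_beta)

text \<open>The slice contains, over an object \<open>e\<close>, all horizontal morphisms \<open>e \<rightarrow> z\<close>, and over a
  vertical \<open>u\<close> all squares from \<open>u\<close> to \<open>e\<^sub>z\<close>. So a bijective projection gives unique existence at once.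
  Conversely, choosing the unique fillers is a section of the projection. It is a double functor
  because composites of fillers, and identities on them, are again fillers, and it is inverse to the
  projection because there are no others.\<close>
lemma double_terminal_iff_unique:
  "double_terminal C z \<longleftrightarrow> z \<in> dobj C \<and>
    (\<forall>e\<in>dobj C. \<exists>!g. g \<in> hor C \<and> hdom C g = e \<and> hcod C g = z) \<and>
    (\<forall>u\<in>ver C. \<exists>!\<eta>. \<eta> \<in> sq C \<and> sleft C \<eta> = u \<and> sright C \<eta> = vid C z)"
    (is "?T \<longleftrightarrow> z \<in> dobj C \<and> ?H \<and> ?V")
proof (intro iffI conjI)
  assume ?T
  then have z: "z \<in> dobj C" and iso: "double_iso (slice C z) C slice_proj"
    by (auto simp: double_terminal_def)
  then show "z \<in> dobj C" by simp
  obtain G where G: "double_functor C (slice C z) G"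
    and ob: "\<forall>x\<in>dobj (slice C z). dfo G (fst x) = x"
      "\<forall>x\<in>dobj C. fst (dfo G x) = x"
    and ve: "\<forall>u\<in>ver (slice C z). dfv G (fst u) = u"
      "\<forall>u\<in>ver C. fst (dfv G u) = u"
    using iso unfolding double_iso_def slice_proj_def
    by (elim conjE exE) (rule that; simp)
  have Gob: "dfo G e \<in> dobj (slice C z)" if "e \<in> dobj C" for e
    using G that unfolding double_functor_def ftor_between_def by fastforce
  have Gve: "dfv G u \<in> ver (slice C z)" if "u \<in> ver C" for u
    using G that unfolding double_functor_def ftor_between_def[of "hsq_cat _"] by fastforce
  show ?H
  proof
    fix e assume e: "e \<in> dobj C"
    show "\<exists>!g. g \<in> hor C \<and> hdom C g = e \<and> hcod C g = z"
    proof (rule ex1I[of _ "snd (dfo G e)"])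
      show "snd (dfo G e) \<in> hor C \<and> hdom C (snd (dfo G e)) = e \<and> hcod C (snd (dfo G e)) = z"
        using Gob[OF e] bspec[OF ob(2) e] by (auto simp: slice_sel chom_iff)
      fix g assume "g \<in> hor C \<and> hdom C g = e \<and> hcod C g = z"
      then have "(e, g) \<in> dobj (slice C z)" by (auto simp: slice_sel chom_iff)
      then show "g = snd (dfo G e)" using ob(1) by force
    qed
  qed
  show ?V
  proof
    fix u assume u: "u \<in> ver C"
    show "\<exists>!\<eta>. \<eta> \<in> sq C \<and> sleft C \<eta> = u \<and> sright C \<eta> = vid C z"
    proof (rule ex1I[of _ "snd (dfv G u)"])
      show "snd (dfv G u) \<in> sq C \<and> sleft C (snd (dfv G u)) = u \<and> sright C (snd (dfv G u)) = vid C z"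
        using Gve[OF u] bspec[OF ve(2) u] by (auto simp: slice_sel)
      fix \<eta> assume "\<eta> \<in> sq C \<and> sleft C \<eta> = u \<and> sright C \<eta> = vid C z"
      then have "(u, \<eta>) \<in> ver (slice C z)" using u by (auto simp: slice_sel)
      then show "\<eta> = snd (dfv G u)" using ve(1) by force
    qed
  qed
next
  assume unique: "z \<in> dobj C \<and> ?H \<and> ?V"
  note z = unique [THEN conjunct1]
    and H = unique [THEN conjunct2, THEN conjunct1, THEN bspec]
    and V = unique [THEN conjunct2, THEN conjunct2, THEN bspec]
  define t where "t e = (THE g. g \<in> hor C \<and> hdom C g = e \<and> hcod C g = z)" for e
  define \<tau> where "\<tau> u = (THE \<eta>. \<eta> \<in> sq C \<and> sleft C \<eta> = u \<and> sright C \<eta> = vid C z)" for u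
  have t: "t e \<in> hor C \<and> hdom C (t e) = e \<and> hcod C (t e) = z" if "e \<in> dobj C" for e
    unfolding t_def by (rule theI' [OF H [OF that]])
  have t_uniq: "t (hdom C g) = g" if "g \<in> hor C" "hcod C g = z" for g
    unfolding t_def using that by (intro the1_equality H) simp_all
  have \<tau>: "\<tau> u \<in> sq C \<and> sleft C (\<tau> u) = u \<and> sright C (\<tau> u) = vid C z" if "u \<in> ver C" for u
    unfolding \<tau>_def by (rule theI' [OF V [OF that]])
  have \<tau>_uniq: "\<tau> (sleft C \<eta>) = \<eta>" if "\<eta> \<in> sq C" "sright C \<eta> = vid C z" for \<eta>
    unfolding \<tau>_def using that by (intro the1_equality V) simp_all
  \<comment> \<open>Each of the following equations holds because its two sides have the same domain (or left
    boundary) and go to \<open>z\<close>.\<close>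
  have t_comp: "hcomp C (t (hcod C f)) f = t (hdom C f)" if "f \<in> hor C" for f
    using t_uniq[of "hcomp C (t (hcod C f)) f"] t[of "hcod C f"] that by simp
  have \<tau>_comp: "sqh C (\<tau> (sright C \<alpha>)) \<alpha> = \<tau> (sleft C \<alpha>)" if "\<alpha> \<in> sq C" for \<alpha>
    using \<tau>_uniq[of "sqh C (\<tau> (sright C \<alpha>)) \<alpha>"] \<tau>[of "sright C \<alpha>"] that by simp
  have \<tau>_top: "stop C (\<tau> u) = t (vdom C u)" "sbot C (\<tau> u) = t (vcod C u)" if "u \<in> ver C" for u
    using t_uniq[of "stop C (\<tau> u)"] t_uniq[of "sbot C (\<tau> u)"] \<tau>[OF that] z by auto
  have \<tau>_vid: "\<tau> (vid C e) = sqvid C (t e)" if "e \<in> dobj C" for e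
    using \<tau>_uniq[of "sqvid C (t e)"] t[OF that] by auto
  have \<tau>_vcomp: "\<tau> (vcomp C u' u) = sqv C (\<tau> u') (\<tau> u)"
    if "u \<in> ver C" "u' \<in> ver C" "vcod C u = vdom C u'" for u u'
    using \<tau>_uniq[of "sqv C (\<tau> u') (\<tau> u)"] \<tau>[OF that(1)] \<tau>[OF that(2)] \<tau>_top that z by auto
  let ?G = "\<lparr>dfo = \<lambda>e. (e, t e), dfh = \<lambda>f. ((hdom C f, t (hdom C f)), f, (hcod C f, t (hcod C f))),
    dfv = \<lambda>u. (u, \<tau> u), dfs = \<lambda>\<alpha>. ((sleft C \<alpha>, \<tau> (sleft C \<alpha>)), \<alpha>, (sright C \<alpha>, \<tau> (sright C \<alpha>)))\<rparr>"
  have "double_functor C (slice C z) ?G"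
    unfolding double_functor_def
    by (intro conjI; rule ftor_betweenI)
      (simp_all add: slice_sel chom_iff split_beta t t_comp \<tau> \<tau>_comp \<tau>_top \<tau>_vid \<tau>_vcomp)
  moreover have "t e = g" if "(e, g) \<in> dobj (slice C z)" for e g
    using that t_uniq[of g] by (simp add: slice_sel chom_iff)
  moreover have hor_round: "((hdom C f, t (hdom C f)), f, (hcod C f, t (hcod C f))) = (p, f, q)"
    if "(p, f, q) \<in> hor (slice C z)" for p f q
  proof -
    obtain e g d h where "p = (e, g)" "q = (d, h)" by (cases p, cases q)
    with that show ?thesis
      using t_uniq[of g] t_uniq[of h] by (simp add: slice_sel chom_iff)
  qed
  moreover have "\<tau> u = \<eta>" if "(u, \<eta>) \<in> ver (slice C z)" for u \<eta>
    using that \<tau>_uniq[of \<eta>] by (simp add: slice_sel)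
  moreover have sq_round: "((sleft C \<alpha>, \<tau> (sleft C \<alpha>)), \<alpha>, (sright C \<alpha>, \<tau> (sright C \<alpha>))) = (p, \<alpha>, q)"
    if "(p, \<alpha>, q) \<in> sq (slice C z)" for p \<alpha> q
  proof -
    obtain u \<eta> v \<theta> where "p = (u, \<eta>)" "q = (v, \<theta>)" by (cases p, cases q)
    with that show ?thesis
      using \<tau>_uniq[of \<eta>] \<tau>_uniq[of \<theta>] by (simp add: slice_sel)
  qed
  ultimately show ?T
    using z slice_proj_double_functor unfolding double_terminal_def double_iso_def
    by (intro conjI exI[of _ ?G]) (auto simp: slice_proj_def dest: hor_round sq_round)
qed

end

section \<open>The Grothendieck construction is a double category\<close>

locale presheaf_on_double_category = double_category C + lax_double_presheaf C X
  for C :: "('o, 'h, 'v, 's) dcat" and X :: "('o, 'h, 'v, 's, 'a, 'm) presheaf"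
begin

lemma hor_ob_in [simp]:
  "\<lbrakk>f \<in> hor C; b \<in> cobj (pobj X (hcod C f))\<rbrakk> \<Longrightarrow> fob (phor X f) b \<in> cobj (pobj X (hdom C f))"
  using ftor_between.ob_in [OF hor_ftor] .

lemma sq_in:
  assumes "\<alpha> \<in> sq C" "b \<in> cobj (pobj X (vdom C (sright C \<alpha>)))"
    "b' \<in> cobj (pobj X (vcod C (sright C \<alpha>)))" "q \<in> pel (pver X (sright C \<alpha>)) b b'"
  shows "psq X \<alpha> b b' q
    \<in> pel (pver X (sleft C \<alpha>)) (fob (phor X (stop C \<alpha>)) b) (fob (phor X (sbot C \<alpha>)) b')"
  using sq_nat [of \<alpha> "sleft C \<alpha>" "stop C \<alpha>" "sbot C \<alpha>" "sright C \<alpha>"] assms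
  by (simp add: prof_square_def squares_iff)

lemma mu_in:
  assumes "u \<in> ver C" "u' \<in> ver C" "vcod C u = vdom C u'"
    "a \<in> cobj (pobj X (vdom C u))" "b \<in> cobj (pobj X (vcod C u))" "c \<in> cobj (pobj X (vcod C u'))"
    "s \<in> pel (pver X u) a b" "s' \<in> pel (pver X u') b c"
  shows "mu_at C X u u' a c b s' s \<in> pel (pver X (vcomp C u' u)) a c"
proof -
  have "pmu X u u' a c K \<in> pel (pver X (vcomp C u' u)) a c"
    if "K \<in> pel (prof_comp (pobj X (vdom C u)) (pobj X (vcod C u)) (pobj X (vcod C u'))
      (pver X u') (pver X u)) a c" for K
    using mu_nat [OF assms(1-3)] assms(4,6) that by (simp add: prof_square_def id_ftor_def)
  then show ?thesis
    unfolding mu_at_def using assms(5,7,8) by (auto simp: prof_comp_def)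
qed

lemma pel_vid:
  "\<lbrakk>x \<in> dobj C; a \<in> cobj (pobj X x); b \<in> cobj (pobj X x)\<rbrakk>
    \<Longrightarrow> pel (pver X (vid C x)) a b = chom (pobj X x) a b"
  using vid_hom by (auto simp: prof_eq_def hom_prof_def)

text \<open>Normality gives the action of \<open>Xe\<^sub>x\<close> on objects of \<open>Xx\<close> only; the boundaries of the
  arrows involved are such objects.\<close>
lemma act_vid:
  assumes x: "x \<in> dobj C"
    and "f \<in> chom (pobj X x) a' a" "s \<in> chom (pobj X x) a b" "g \<in> chom (pobj X x) b b'"
  shows "pact (pver X (vid C x)) f g s = ccomp (pobj X x) g (ccomp (pobj X x) s f)"
proof -
  interpret Xx: category "pobj X x" by (rule obj_category [OF x])
  have "a \<in> cobj (pobj X x)" "a' \<in> cobj (pobj X x)" "b \<in> cobj (pobj X x)" "b' \<in> cobj (pobj X x)"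
    using assms(2-) Xx.dom_in Xx.cod_in by (auto simp: chom_iff)
  then show ?thesis
    using vid_hom [OF x] assms(2-) pel_vid [OF x] by (simp add: prof_eq_def hom_prof_def)
qed

lemma cid_in_vid:
  "\<lbrakk>x \<in> dobj C; a \<in> cobj (pobj X x)\<rbrakk> \<Longrightarrow> cid (pobj X x) a \<in> pel (pver X (vid C x)) a a"
  by (simp add: pel_vid category.id_in [OF obj_category])

lemma mu_cid_left:
  assumes "u \<in> ver C" "vdom C u = x" "a \<in> cobj (pobj X x)" "c \<in> cobj (pobj X (vcod C u))"
    "s \<in> pel (pver X u) a c"
  shows "mu_at C X (vid C x) u a c a s (cid (pobj X x) a) = s"
  using mu_unit_left [of u "cid (pobj X x) a" a a c s] assms
    category.id_in [OF obj_category, of x a] profunctor.act_id [OF ver_prof, of u a c s]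
  by force

lemma mu_cid_right:
  assumes "u \<in> ver C" "vcod C u = x" "a \<in> cobj (pobj X (vdom C u))" "c \<in> cobj (pobj X x)"
    "s \<in> pel (pver X u) a c"
  shows "mu_at C X u (vid C x) a c c (cid (pobj X x) c) s = s"
  using mu_unit_right [of u a "cid (pobj X x) c" c c s] assms
    category.id_in [OF obj_category, of x c] profunctor.act_id [OF ver_prof, of u a c s]
  by force

lemma sqvid_cid:
  assumes "f \<in> hor C" "b \<in> cobj (pobj X (hcod C f))"
  shows "psq X (sqvid C f) b b (cid (pobj X (hcod C f)) b) =
    cid (pobj X (hdom C f)) (fob (phor X f) b)"
  using assms sqvid_act [of f "cid (pobj X (hcod C f)) b" b b]
    category.id_in [OF obj_category, of "hcod C f" b] ftor_between.pres_id [OF hor_ftor, of f b]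
  by simp

text \<open>This and the next lemma restate functoriality and the naturality of \<open>\<mu>\<close> with the boundaries
  computed from the squares, which is the form in which squares occur in the Grothendieck construction.\<close>
lemma sqh_psq:
  assumes "\<alpha> \<in> sq C" "\<beta> \<in> sq C" "sright C \<alpha> = sleft C \<beta>"
    "a \<in> cobj (pobj X (vdom C (sright C \<beta>)))" "a' \<in> cobj (pobj X (vcod C (sright C \<beta>)))"
    "s \<in> pel (pver X (sright C \<beta>)) a a'"
  shows "psq X (sqh C \<beta> \<alpha>) a a' s =
    psq X \<alpha> (fob (phor X (stop C \<beta>)) a) (fob (phor X (sbot C \<beta>)) a') (psq X \<beta> a a' s)"
  using assms by (intro sqh_eq) (simp_all add: squares_iff)

lemma sqv_psq:
  assumes "\<alpha> \<in> sq C" "\<alpha>' \<in> sq C" "sbot C \<alpha> = stop C \<alpha>'"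
    "a \<in> cobj (pobj X (vdom C (sright C \<alpha>)))" "b \<in> cobj (pobj X (vcod C (sright C \<alpha>)))"
    "c \<in> cobj (pobj X (vcod C (sright C \<alpha>')))"
    "s \<in> pel (pver X (sright C \<alpha>)) a b" "s' \<in> pel (pver X (sright C \<alpha>')) b c"
  shows "psq X (sqv C \<alpha>' \<alpha>) a c (mu_at C X (sright C \<alpha>) (sright C \<alpha>') a c b s' s) =
    mu_at C X (sleft C \<alpha>) (sleft C \<alpha>') (fob (phor X (stop C \<alpha>)) a) (fob (phor X (sbot C \<alpha>')) c)
      (fob (phor X (sbot C \<alpha>)) b) (psq X \<alpha>' b c s') (psq X \<alpha> a b s)"
  using assms by (intro mu_natural) (simp_all add: squares_iff)

lemma groth_sel:
  "dobj (groth C X) = {(x, a). x \<in> dobj C \<and> a \<in> cobj (pobj X x)}"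
  "hor (groth C X) = {(a, f, b). f \<in> hor C \<and> b \<in> cobj (pobj X (hcod C f)) \<and> a = fob (phor X f) b}"
  "hdom (groth C X) = (\<lambda>(a, f, b). (hdom C f, a))"
  "hcod (groth C X) = (\<lambda>(a, f, b). (hcod C f, b))"
  "hid (groth C X) = (\<lambda>(x, a). (a, hid C x, a))"
  "hcomp (groth C X) = (\<lambda>(b', g, c) (a, f, b). (a, hcomp C g f, c))"
  "ver (groth C X) = {(a, u, p, a'). u \<in> ver C \<and> a \<in> cobj (pobj X (vdom C u)) \<and>
     a' \<in> cobj (pobj X (vcod C u)) \<and> p \<in> pel (pver X u) a a'}"
  "vdom (groth C X) = (\<lambda>(a, u, p, a'). (vdom C u, a))"
  "vcod (groth C X) = (\<lambda>(a, u, p, a'). (vcod C u, a'))"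
  "vid (groth C X) = (\<lambda>(x, a). (a, vid C x, cid (pobj X x) a, a))"
  "vcomp (groth C X) = (\<lambda>(b', u', p', c) (a, u, p, b).
     (a, vcomp C u' u, mu_at C X u u' a c b p' p, c))"
  "sq (groth C X) = {((a, u, p, a'), \<alpha>, (b, v, q, b')).
     (a, u, p, a') \<in> ver (groth C X) \<and> (b, v, q, b') \<in> ver (groth C X) \<and>
     \<alpha> \<in> sq C \<and> sleft C \<alpha> = u \<and> sright C \<alpha> = v \<and>
     a = fob (phor X (stop C \<alpha>)) b \<and> a' = fob (phor X (sbot C \<alpha>)) b' \<and> p = psq X \<alpha> b b' q}"
  "sleft (groth C X) = (\<lambda>(U, \<alpha>, V). U)"
  "sright (groth C X) = (\<lambda>(U, \<alpha>, V). V)"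
  "stop (groth C X) = (\<lambda>((a, u, p, a'), \<alpha>, (b, v, q, b')). (a, stop C \<alpha>, b))"
  "sbot (groth C X) = (\<lambda>((a, u, p, a'), \<alpha>, (b, v, q, b')). (a', sbot C \<alpha>, b'))"
  "sqhid (groth C X) = (\<lambda>(a, u, p, a'). ((a, u, p, a'), sqhid C u, (a, u, p, a')))"
  "sqh (groth C X) = (\<lambda>(V', \<beta>, W) (U, \<alpha>, V). (U, sqh C \<beta> \<alpha>, W))"
  "sqvid (groth C X) = (\<lambda>(a, f, b).
     (vid (groth C X) (hdom C f, a), sqvid C f, vid (groth C X) (hcod C f, b)))"
  "sqv (groth C X) = (\<lambda>(U', \<alpha>', V') (U, \<alpha>, V).
     (vcomp (groth C X) U' U, sqv C \<alpha>' \<alpha>, vcomp (groth C X) V' V))"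
  by (auto simp: groth_def Let_def)

lemma groth_hor_category: "category (hor_cat (groth C X))"
  by (rule categoryI)
    (auto simp: groth_sel hid_ob hcomp_ob hcomp_assoc)

text \<open>Unit and associativity laws for vertical morphisms are those of \<open>\<mu>\<close>.\<close>
lemma groth_ver_category: "category (ver_cat (groth C X))"
  by (rule categoryI)
    (auto simp: groth_sel cid_in_vid mu_in mu_cid_left mu_cid_right mu_assoc vcomp_assoc)

lemma groth_hsq_category: "category (hsq_cat (groth C X))"
  by (rule categoryI) (auto simp: groth_sel hid_ob hcomp_ob sqhid_eq sqh_psq sqh_assoc)

text \<open>Vertical composites of squares are squares by naturality of \<open>\<mu>\<close>, and \<open>e\<^sub>f\<close> is a square between
  vertical identities because \<open>Xf\<close> preserves identities and \<open>Xe\<^sub>f\<close> is its action on arrows.\<close>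
lemma groth_vsq_category: "category (vsq_cat (groth C X))"
  by (rule categoryI; simp only: split_paired_all vsq_cat_sel)
    (simp_all add: groth_sel cid_in_vid mu_in mu_cid_left mu_cid_right mu_assoc vcomp_assoc
      sqvid_cid sqv_psq sqv_assoc)

lemma groth_double_category: "double_category (groth C X)"
  by (intro double_category.intro groth_hor_category groth_ver_category groth_hsq_category
      groth_vsq_category; simp only: split_paired_all)
    (simp_all add: groth_sel interchange sqh_sqvid sqv_sqhid)

end

section \<open>Representables are lax double presheaves\<close>

lemma coend_rel_invariant:
  assumes "(t, t') \<in> coend_rel A M B U U' a c"
    and "\<And>t t'. (t, t') \<in> coend_gen A M B U U' a c \<Longrightarrow> P t \<longleftrightarrow> P t'"
  shows "P t \<longleftrightarrow> P t'"
  using assms(1) unfolding coend_rel_def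
  by (induction rule: rtrancl_induct) (use assms(2) in auto)

lemma coend_class_self: "t \<in> coend_class A M B U U' a c t"
  by (simp add: coend_class_def coend_rel_def)

locale representable_at = double_category C for C :: "('o, 'h, 'v, 's) dcat" +
  fixes z :: 'o
  assumes z: "z \<in> dobj C"
begin

abbreviation R :: "('o, 'h, 'v, 's, 'h, 's) presheaf" where "R \<equiv> representable C z"

lemma rep_sel:
  "cobj (pobj R x) = chom (hor_cat C) x z"
  "carr (pobj R x) = {\<eta> \<in> sq C. sleft C \<eta> = vid C x \<and> sright C \<eta> = vid C z}"
  "cdom (pobj R x) = stop C" "ccod (pobj R x) = sbot C"
  "cid (pobj R x) = sqvid C" "ccomp (pobj R x) = sqv C"
  "fob (phor R f) g = hcomp C g f" "far (phor R f) \<eta> = sqh C \<eta> (sqvid C f)"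
  "pel (pver R u) g g' = squares C u g g' (vid C z)"
  "pact (pver R u) \<beta> \<beta>' \<eta> = sqv C \<beta>' (sqv C \<eta> \<beta>)"
  "psq R \<alpha> g g' \<eta> = sqh C \<eta> \<alpha>"
  "pmu R u u' g g'' K = the_elem ((\<lambda>(g', \<alpha>', \<alpha>). sqv C \<alpha>' \<alpha>) ` K)"
  by (simp_all add: representable_def)

lemmas rep_iff = rep_sel chom_iff squares_iff

lemma rep_category: "x \<in> dobj C \<Longrightarrow> category (pobj R x)"
  using z by (intro categoryI) (simp_all add: rep_iff sqv_assoc)

lemma rep_profunctor:
  "u \<in> ver C \<Longrightarrow> profunctor (pobj R (vdom C u)) (pobj R (vcod C u)) (pver R u)"
  using z by unfold_locales (simp_all add: rep_iff sqv_assoc)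

lemma rep_hor_ftor:
  "f \<in> hor C \<Longrightarrow> ftor_between (pobj R (hcod C f)) (pobj R (hdom C f)) (phor R f)"
  using z by (intro ftor_betweenI) (simp_all add: rep_iff sqh_sqvid interchange)

lemma rep_sq_nat:
  "\<alpha> \<in> squares C u f f' v \<Longrightarrow> prof_square (pobj R (hcod C f)) (pobj R (hcod C f'))
    (pver R v) (phor R f) (phor R f') (pver R u) (psq R \<alpha>)"
  unfolding prof_square_def using z by (auto simp add: rep_iff interchange)

text \<open>The component of \<open>\<mu>\<close> is read off from a coend class as the value of \<open>\<alpha>' \<bullet> \<alpha>\<close> common to all its
  members. To see that there is one, the well-typed triples with a fixed value are shown
  to be closed under the relation of the coend.\<close>

definition factorisations :: "'v \<Rightarrow> 'v \<Rightarrow> 'h \<Rightarrow> 'h \<Rightarrow> 's \<Rightarrow> ('h \<times> 's \<times> 's) set" where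
  "factorisations u u' g g'' \<eta> = {(g', \<alpha>', \<alpha>). \<alpha> \<in> squares C u g g' (vid C z) \<and>
     \<alpha>' \<in> squares C u' g' g'' (vid C z) \<and> sqv C \<alpha>' \<alpha> = \<eta>}"

text \<open>A generator of the relation moves a square \<open>\<kappa>\<close> from one factor to the other:
  \<open>(\<alpha>' \<bullet> \<kappa>) \<bullet> \<alpha> = \<alpha>' \<bullet> (\<kappa> \<bullet> \<alpha>)\<close>.\<close>
lemma coend_gen_factorisations:
  assumes "u \<in> ver C" "u' \<in> ver C" "vcod C u = vdom C u'"
    and "(t, t') \<in> coend_gen (pobj R (vdom C u)) (pobj R (vcod C u)) (pobj R (vcod C u'))
      (pver R u) (pver R u') g g''"
  shows "t \<in> factorisations u u' g g'' \<eta> \<longleftrightarrow> t' \<in> factorisations u u' g g'' \<eta>"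
  using assms z
  by (auto simp: coend_gen_def factorisations_def rep_iff sqv_assoc)

lemma coend_rel_factorisations:
  assumes "u \<in> ver C" "u' \<in> ver C" "vcod C u = vdom C u'"
    and "T \<subseteq> factorisations u u' g g'' \<eta>"
  shows "coend_rel (pobj R (vdom C u)) (pobj R (vcod C u)) (pobj R (vcod C u'))
      (pver R u) (pver R u') g g'' `` T \<subseteq> factorisations u u' g g'' \<eta>"
proof
  fix t' assume "t' \<in> coend_rel (pobj R (vdom C u)) (pobj R (vcod C u)) (pobj R (vcod C u'))
      (pver R u) (pver R u') g g'' `` T"
  then obtain t where t: "t \<in> T" and rel: "(t, t') \<in> coend_rel (pobj R (vdom C u))
      (pobj R (vcod C u)) (pobj R (vcod C u')) (pver R u) (pver R u') g g''" by (rule ImageE)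
  have "t \<in> factorisations u u' g g'' \<eta> \<longleftrightarrow> t' \<in> factorisations u u' g g'' \<eta>"
    using rel by (rule coend_rel_invariant) (rule coend_gen_factorisations [OF assms(1-3)])
  then show "t' \<in> factorisations u u' g g'' \<eta>" using t assms(4) by blast
qed

text \<open>Only the set \<open>K\<close> determines the value of the component, so it may be evaluated without
  knowing that \<open>K\<close> is a single class. This is convenient for the action on a composite profunctor,
  which is defined by saturation.\<close>
lemma pmu_rep:
  assumes "K \<noteq> {}" "K \<subseteq> factorisations u u' g g'' \<eta>"
  shows "pmu R u u' h h'' K = \<eta>"
proof -
  have "(\<lambda>(g', \<alpha>', \<alpha>). sqv C \<alpha>' \<alpha>) ` K = {\<eta>}"
    using assms by (force simp: factorisations_def)
  then show ?thesis by (simp add: rep_sel)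
qed

lemma mu_at_rep:
  assumes "u \<in> ver C" "u' \<in> ver C" "vcod C u = vdom C u'"
    and "\<alpha> \<in> squares C u g g' (vid C z)" "\<alpha>' \<in> squares C u' g' g'' (vid C z)"
  shows "mu_at C R u u' g g'' g' \<alpha>' \<alpha> = sqv C \<alpha>' \<alpha>"
  unfolding mu_at_def
proof (rule pmu_rep)
  show "coend_class (pobj R (vdom C u)) (pobj R (vcod C u)) (pobj R (vcod C u'))
      (pver R u) (pver R u') g g'' (g', \<alpha>', \<alpha>) \<subseteq> factorisations u u' g g'' (sqv C \<alpha>' \<alpha>)"
    unfolding coend_class_def using assms
    by (intro coend_rel_factorisations) (simp_all add: factorisations_def)
qed (use coend_class_self in fast)

lemma rep_mu_nat:
  assumes u: "u \<in> ver C" "u' \<in> ver C" "vcod C u = vdom C u'"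
  shows "prof_square (pobj R (vdom C u)) (pobj R (vcod C u'))
    (prof_comp (pobj R (vdom C u)) (pobj R (vcod C u)) (pobj R (vcod C u')) (pver R u') (pver R u))
    id_ftor id_ftor (pver R (vcomp C u' u)) (pmu R u u')"
proof -
  let ?P = "prof_comp (pobj R (vdom C u)) (pobj R (vcod C u)) (pobj R (vcod C u'))
    (pver R u') (pver R u)"
  have ex: "\<exists>\<eta>\<in>squares C (vcomp C u' u) a c (vid C z).
      K \<noteq> {} \<and> K \<subseteq> factorisations u u' a c \<eta>" if K: "K \<in> pel ?P a c" for a c K
  proof -
    obtain b s' s where K_def: "K = coend_class (pobj R (vdom C u)) (pobj R (vcod C u))
        (pobj R (vcod C u')) (pver R u) (pver R u') a c (b, s', s)"
      and s: "s' \<in> pel (pver R u') b c" "s \<in> pel (pver R u) a b"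
      using K by (auto simp: prof_comp_def)
    have "K \<subseteq> factorisations u u' a c (sqv C s' s)"
      unfolding K_def coend_class_def using s u
      by (intro coend_rel_factorisations) (simp_all add: factorisations_def rep_sel)
    moreover have "K \<noteq> {}" using K_def coend_class_self by fast
    moreover have "sqv C s' s \<in> squares C (vcomp C u' u) a c (vid C z)"
      using s u z by (auto simp: rep_iff)
    ultimately show ?thesis by blast
  qed
  have act: "pmu R u u' b d (pact ?P f g K) = sqv C g (sqv C (pmu R u u' a c K) f)"
    if f: "f \<in> chom (pobj R (vdom C u)) b a" and g: "g \<in> chom (pobj R (vcod C u')) c d"
      and K: "K \<in> pel ?P a c" for a b c d f g K
  proof -
    obtain \<eta> where \<eta>: "\<eta> \<in> squares C (vcomp C u' u) a c (vid C z)"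
      "K \<noteq> {}" "K \<subseteq> factorisations u u' a c \<eta>"
      using ex [OF K] by blast
    \<comment> \<open>The action moves a factorisation of \<open>\<eta>\<close> to one of \<open>g \<bullet> \<eta> \<bullet> f\<close>, and saturating the image
      does not leave the factorisations of that square.\<close>
    let ?T = "(\<lambda>(m, s', s). (m, pact (pver R u') (cid (pobj R (vcod C u)) m) g s',
      pact (pver R u) f (cid (pobj R (vcod C u)) m) s)) ` K"
    have "?T \<subseteq> factorisations u u' b d (sqv C g (sqv C \<eta> f))"
    proof clarify
      fix m s' s assume "(m, s', s) \<in> K"
      then have "(m, s', s) \<in> factorisations u u' a c \<eta>" using \<eta> by blast
      then show "(m, pact (pver R u') (cid (pobj R (vcod C u)) m) g s',
          pact (pver R u) f (cid (pobj R (vcod C u)) m) s)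
          \<in> factorisations u u' b d (sqv C g (sqv C \<eta> f))"
        using f g u z by (auto simp: factorisations_def rep_iff sqv_assoc)
    qed
    then have "pact ?P f g K \<subseteq> factorisations u u' b d (sqv C g (sqv C \<eta> f))"
      using coend_rel_factorisations [OF u] f g by (simp add: prof_comp_def chom_iff)
    moreover have "pact ?P f g K \<noteq> {}"
      using \<eta>(2) by (fastforce simp: prof_comp_def coend_rel_def)
    ultimately show ?thesis
      using pmu_rep \<eta>(2,3) by metis
  qed
  have "pmu R u u' a c K \<in> squares C (vcomp C u' u) a c (vid C z)" if "K \<in> pel ?P a c" for a c K
    using ex [OF that] pmu_rep by metis
  then show ?thesis
    unfolding prof_square_def using act by (simp add: rep_sel id_ftor_def)
qed

lemma rep_vid_hom:
  "x \<in> dobj C \<Longrightarrow> prof_eq (pobj R x) (pobj R x) (pver R (vid C x)) (hom_prof (pobj R x))"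
  by (simp add: prof_eq_def hom_prof_def set_eq_iff rep_iff sqv_assoc conj_ac)

lemma rep_lax_double_presheaf: "lax_double_presheaf C R"
  by (intro lax_double_presheaf.intro rep_category rep_profunctor rep_hor_ftor rep_sq_nat
      rep_mu_nat rep_vid_hom; assumption?)
    (use z in \<open>simp_all add: rep_iff mu_at_rep interchange hcomp_assoc sqv_assoc sqh_assoc
      flip: sqh_sqvid\<close>)

end

section \<open>The Yoneda correspondence\<close>

context presheaf_on_double_category
begin

lemma chom_objects:
  assumes "x \<in> dobj C" "k \<in> chom (pobj X x) a b"
  shows "a \<in> cobj (pobj X x)" "b \<in> cobj (pobj X x)"
  using assms category.dom_in [OF obj_category] category.cod_in [OF obj_category]
  by (auto simp: chom_iff)

text \<open>The action of arrows on \<open>Xu\<close> can be recovered from \<open>\<mu>\<close> by normality. So whatever is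
  compatible with \<open>\<mu>\<close> and with arrows is compatible with actions; the naturality of the Yoneda
  transformation on profunctors is obtained in this way.\<close>
lemma act_eq_mu:
  assumes u: "u \<in> ver C" and k: "k \<in> chom (pobj X (vdom C u)) a' a"
    and s: "s \<in> pel (pver X u) a b" and k': "k' \<in> chom (pobj X (vcod C u)) b b'"
  shows "pact (pver X u) k k' s =
    mu_at C X u (vid C (vcod C u)) a' b' b k' (mu_at C X (vid C (vdom C u)) u a' b a s k)"
proof -
  interpret A: category "pobj X (vdom C u)" using u by (simp add: obj_category)
  interpret B: category "pobj X (vcod C u)" using u by (simp add: obj_category)
  interpret U: profunctor "pobj X (vdom C u)" "pobj X (vcod C u)" "pver X u"
    using u by (rule ver_prof)
  have ob: "a \<in> cobj (pobj X (vdom C u))" "a' \<in> cobj (pobj X (vdom C u))"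
    "b \<in> cobj (pobj X (vcod C u))" "b' \<in> cobj (pobj X (vcod C u))"
    using u chom_objects [OF _ k] chom_objects [OF _ k'] by simp_all
  have "mu_at C X (vid C (vdom C u)) u a' b a s k = pact (pver X u) k (cid (pobj X (vcod C u)) b) s"
    by (rule mu_unit_left [OF u k ob(3) s])
  moreover have "\<dots> \<in> pel (pver X u) a' b"
    using k s ob B.id_in by (intro U.act_in)
  ultimately have "mu_at C X u (vid C (vcod C u)) a' b' b k'
      (mu_at C X (vid C (vdom C u)) u a' b a s k) =
    pact (pver X u) (cid (pobj X (vdom C u)) a') k' (pact (pver X u) k (cid (pobj X (vcod C u)) b) s)"
    using mu_unit_right [OF u ob(2) k'] by simp
  also have "\<dots> = pact (pver X u) (ccomp (pobj X (vdom C u)) k (cid (pobj X (vdom C u)) a'))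
      (ccomp (pobj X (vcod C u)) k' (cid (pobj X (vcod C u)) b)) s"
    using k k' s ob A.id_in B.id_in by (intro U.act_comp [symmetric])
  also have "\<dots> = pact (pver X u) k k' s"
    using A.id_right [OF k] B.id_right [OF k'] by simp
  finally show ?thesis ..
qed

text \<open>Likewise \<open>\<mu>\<close> at vertical identities is composition of arrows, from which
  functoriality of the Yoneda transformation will follow.\<close>
lemma mu_vid_vid:
  assumes x: "x \<in> dobj C" and k: "k \<in> chom (pobj X x) a b" and k': "k' \<in> chom (pobj X x) b c"
  shows "mu_at C X (vid C x) (vid C x) a c b k' k = ccomp (pobj X x) k' k"
proof -
  interpret A: category "pobj X x" using x by (rule obj_category)
  have c: "c \<in> cobj (pobj X x)" "b \<in> cobj (pobj X x)" using chom_objects [OF x k'] by simp_all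
  have "mu_at C X (vid C x) (vid C x) a c b k' k = pact (pver X (vid C x)) k (cid (pobj X x) c) k'"
    using mu_unit_left [of "vid C x" k a b c k'] x k k' c by (simp add: pel_vid)
  also have "\<dots> = ccomp (pobj X x) (cid (pobj X x) c) (ccomp (pobj X x) k' k)"
    by (rule act_vid [OF x k k' A.id_in [OF c(1)]])
  also have "\<dots> = ccomp (pobj X x) k' k" by (rule A.id_left [OF A.comp_in [OF k k']])
  finally show ?thesis .
qed

end

locale presheaf_with_element = presheaf_on_double_category C X
  for C :: "('o, 'h, 'v, 's) dcat" and X :: "('o, 'h, 'v, 's, 'a, 'm) presheaf" +
  fixes z :: 'o and c :: 'a
  assumes z_ob: "z \<in> dobj C" and c: "c \<in> cobj (pobj X z)"
begin

sublocale representable_at C z by unfold_locales (rule z_ob)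

text \<open>The element \<open>X\<eta>(1\<^sub>c)\<close> that is classified by a square \<open>\<eta>\<close> into \<open>e\<^sub>z\<close>.\<close>
definition elt :: "'s \<Rightarrow> 'm" where "elt \<eta> = psq X \<eta> c c (cid (pobj X z) c)"

definition yoneda_trans :: "('o, 'v, 'h, 's, 'a, 'm) htrans" where
  "yoneda_trans = \<lparr>tob = (\<lambda>x. \<lparr>fob = (\<lambda>g. fob (phor X g) c), far = elt\<rparr>), tver = (\<lambda>u g g'. elt)\<rparr>"

lemma elt_in:
  "\<lbrakk>\<eta> \<in> sq C; sright C \<eta> = vid C z\<rbrakk>
    \<Longrightarrow> elt \<eta> \<in> pel (pver X (sleft C \<eta>)) (fob (phor X (stop C \<eta>)) c) (fob (phor X (sbot C \<eta>)) c)"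
  unfolding elt_def using z c by (intro sq_in) (simp_all add: cid_in_vid)

text \<open>Naturality of \<open>\<mu>\<close>, applied to \<open>1\<^sub>c = \<mu>[1\<^sub>c, 1\<^sub>c]\<close>.\<close>
lemma elt_sqv:
  assumes "\<eta> \<in> sq C" "\<eta>' \<in> sq C" "sright C \<eta> = vid C z" "sright C \<eta>' = vid C z"
    "sbot C \<eta> = stop C \<eta>'"
  shows "elt (sqv C \<eta>' \<eta>) = mu_at C X (sleft C \<eta>) (sleft C \<eta>') (fob (phor X (stop C \<eta>)) c)
    (fob (phor X (sbot C \<eta>')) c) (fob (phor X (sbot C \<eta>)) c) (elt \<eta>') (elt \<eta>)"
  using sqv_psq [of \<eta> \<eta>' c c c "cid (pobj X z) c" "cid (pobj X z) c"] assms z c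
  by (simp add: elt_def mu_cid_left cid_in_vid)

lemma elt_sqh:
  assumes "\<eta> \<in> sq C" "\<alpha> \<in> sq C" "sright C \<alpha> = sleft C \<eta>" "sright C \<eta> = vid C z"
  shows "elt (sqh C \<eta> \<alpha>) =
    psq X \<alpha> (fob (phor X (stop C \<eta>)) c) (fob (phor X (sbot C \<eta>)) c) (elt \<eta>)"
  unfolding elt_def using sqh_psq [of \<alpha> \<eta> c c "cid (pobj X z) c"] assms z c
  by (simp add: cid_in_vid)

lemma elt_sqvid:
  "\<lbrakk>g \<in> hor C; hcod C g = z\<rbrakk> \<Longrightarrow> elt (sqvid C g) = cid (pobj X (hdom C g)) (fob (phor X g) c)"
  unfolding elt_def using sqvid_cid [of g c] c by simp

lemma elt_in_chom:
  assumes "\<eta> \<in> carr (pobj R x)" "x \<in> dobj C"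
  shows "elt \<eta> \<in> chom (pobj X x) (fob (phor X (stop C \<eta>)) c) (fob (phor X (sbot C \<eta>)) c)"
proof -
  have \<eta>: "\<eta> \<in> sq C" "sleft C \<eta> = vid C x" "sright C \<eta> = vid C z" using assms by (simp_all add: rep_sel)
  then have "fob (phor X (stop C \<eta>)) c \<in> cobj (pobj X x)" "fob (phor X (sbot C \<eta>)) c \<in> cobj (pobj X x)"
    using hor_ob_in [of "stop C \<eta>" c] hor_ob_in [of "sbot C \<eta>" c] z c assms by simp_all
  then show ?thesis using elt_in [OF \<eta>(1,3)] \<eta> assms by (simp add: pel_vid)
qed

lemma yoneda_ob_ftor:
  assumes x: "x \<in> dobj C"
  shows "ftor_between (pobj R x) (pobj X x) (tob yoneda_trans x)"
proof (rule ftor_betweenI)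
  fix g assume "g \<in> cobj (pobj R x)"
  then show "fob (tob yoneda_trans x) g \<in> cobj (pobj X x)"
    and "far (tob yoneda_trans x) (cid (pobj R x) g) = cid (pobj X x) (fob (tob yoneda_trans x) g)"
    using c hor_ob_in [of g c] by (simp_all add: yoneda_trans_def rep_iff elt_sqvid)
next
  fix \<eta> assume "\<eta> \<in> carr (pobj R x)"
  then show "far (tob yoneda_trans x) \<eta> \<in> carr (pobj X x) \<and>
      cdom (pobj X x) (far (tob yoneda_trans x) \<eta>) = fob (tob yoneda_trans x) (cdom (pobj R x) \<eta>) \<and>
      ccod (pobj X x) (far (tob yoneda_trans x) \<eta>) = fob (tob yoneda_trans x) (ccod (pobj R x) \<eta>)"
    using elt_in_chom [OF _ x, of \<eta>] by (simp add: yoneda_trans_def rep_sel chom_iff)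
next
  fix \<eta> \<eta>' assume \<eta>: "\<eta> \<in> carr (pobj R x)" "\<eta>' \<in> carr (pobj R x)"
    "ccod (pobj R x) \<eta> = cdom (pobj R x) \<eta>'"
  have "elt (sqv C \<eta>' \<eta>) = ccomp (pobj X x) (elt \<eta>') (elt \<eta>)"
    using \<eta> x elt_sqv [of \<eta> \<eta>'] mu_vid_vid [OF x elt_in_chom [OF \<eta>(1) x]]
      elt_in_chom [OF \<eta>(2) x]
    by (simp add: rep_sel)
  then show "far (tob yoneda_trans x) (ccomp (pobj R x) \<eta>' \<eta>) =
      ccomp (pobj X x) (far (tob yoneda_trans x) \<eta>') (far (tob yoneda_trans x) \<eta>)"
    by (simp add: yoneda_trans_def rep_sel)
qed

lemma yoneda_ver_nat:
  assumes u: "u \<in> ver C"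
  shows "prof_square (pobj R (vdom C u)) (pobj R (vcod C u)) (pver R u)
    (tob yoneda_trans (vdom C u)) (tob yoneda_trans (vcod C u)) (pver X u) (tver yoneda_trans u)"
proof -
  have "elt (sqv C \<beta>' (sqv C \<eta> \<beta>)) = pact (pver X u) (elt \<beta>) (elt \<beta>') (elt \<eta>)"
    if "\<beta> \<in> chom (pobj R (vdom C u)) h g" "\<beta>' \<in> chom (pobj R (vcod C u)) g' h'"
      "\<eta> \<in> pel (pver R u) g g'" for g g' h h' \<eta> \<beta> \<beta>'
    using that u z elt_in_chom [of \<beta> "vdom C u"] elt_in_chom [of \<beta>' "vcod C u"] elt_in [of \<eta>]
      act_eq_mu [OF u, of "elt \<beta>" "fob (phor X h) c" "fob (phor X g) c" "elt \<eta>"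
        "fob (phor X g') c" "elt \<beta>'" "fob (phor X h') c"]
      elt_sqv [of "sqv C \<eta> \<beta>" \<beta>'] elt_sqv [of \<beta> \<eta>]
    by (simp add: rep_iff)
  then show ?thesis
    unfolding prof_square_def using elt_in
    by (auto simp: yoneda_trans_def rep_sel squares_iff)
qed

lemma yoneda_transformation: "horizontal_transformation C R X yoneda_trans"
proof (rule horizontal_transformation.intro [OF yoneda_ob_ftor yoneda_ver_nat])
  fix f g assume "f \<in> hor C" "g \<in> cobj (pobj R (hcod C f))"
  then show "fob (tob yoneda_trans (hdom C f)) (fob (phor R f) g) =
      fob (phor X f) (fob (tob yoneda_trans (hcod C f)) g)"
    using c by (simp add: yoneda_trans_def rep_iff hcomp_ob)
next
  fix f \<eta> assume f: "f \<in> hor C" and \<eta>: "\<eta> \<in> carr (pobj R (hcod C f))"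
  then show "far (tob yoneda_trans (hdom C f)) (far (phor R f) \<eta>) =
      far (phor X f) (far (tob yoneda_trans (hcod C f)) \<eta>)"
    using sqvid_act [OF f elt_in_chom [OF \<eta>]] elt_sqh [of \<eta> "sqvid C f"]
    by (simp add: yoneda_trans_def rep_sel)
next
  fix \<alpha> u f f' v g g' \<eta>
  assume "\<alpha> \<in> squares C u f f' v" "\<eta> \<in> pel (pver R v) g g'"
  then show "tver yoneda_trans u (fob (phor R f) g) (fob (phor R f') g') (psq R \<alpha> g g' \<eta>) =
      psq X \<alpha> (fob (tob yoneda_trans (hcod C f)) g) (fob (tob yoneda_trans (hcod C f')) g')
        (tver yoneda_trans v g g' \<eta>)"
    by (auto simp: yoneda_trans_def rep_sel squares_iff elt_sqh)
next
  fix u u' g g' g'' \<eta> \<eta>'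
  assume "u \<in> ver C" "u' \<in> ver C" "vcod C u = vdom C u'"
    "\<eta> \<in> pel (pver R u) g g'" "\<eta>' \<in> pel (pver R u') g' g''"
  then show "tver yoneda_trans (vcomp C u' u) g g'' (mu_at C R u u' g g'' g' \<eta>' \<eta>) =
      mu_at C X u u' (fob (tob yoneda_trans (vdom C u)) g) (fob (tob yoneda_trans (vcod C u')) g'')
        (fob (tob yoneda_trans (vcod C u)) g') (tver yoneda_trans u' g' g'' \<eta>')
        (tver yoneda_trans u g g' \<eta>)"
    using elt_sqv [of \<eta> \<eta>'] mu_at_rep [of u u' \<eta> g g' \<eta>' g'']
    by (simp add: yoneda_trans_def rep_sel squares_iff)
next
  fix x k a b
  show "tver yoneda_trans (vid C x) a b k = far (tob yoneda_trans x) k"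
    by (simp add: yoneda_trans_def)
qed

text \<open>Bijectivity on objects and on elements of profunctors is enough: arrows of \<open>Xx\<close> are elements
  of \<open>Xe\<^sub>x\<close> by normality.\<close>
definition yoneda_bijective :: bool where
  "yoneda_bijective \<longleftrightarrow>
    (\<forall>x\<in>dobj C. bij_betw (\<lambda>g. fob (phor X g) c) (chom (hor_cat C) x z) (cobj (pobj X x))) \<and>
    (\<forall>u\<in>ver C. \<forall>g\<in>chom (hor_cat C) (vdom C u) z. \<forall>g'\<in>chom (hor_cat C) (vcod C u) z.
      bij_betw elt (squares C u g g' (vid C z))
        (pel (pver X u) (fob (phor X g) c) (fob (phor X g') c)))"

text \<open>The Yoneda argument: \<open>g = 1\<^sub>z \<circ> g\<close> and \<open>\<eta> = e\<^bsub>1\<^sub>z\<^esub> \<circ> \<eta>\<close>, so naturality determines \<open>F\<close> by its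
  value at \<open>1\<^sub>z\<close>.\<close>
lemma transformation_eq_yoneda:
  assumes F: "horizontal_transformation C R X F" and F_c: "fob (tob F z) (hid C z) = c"
  shows "\<And>x g. g \<in> chom (hor_cat C) x z \<Longrightarrow> fob (tob F x) g = fob (phor X g) c"
    and "\<And>u g g' \<eta>. \<eta> \<in> squares C u g g' (vid C z) \<Longrightarrow> tver F u g g' \<eta> = elt \<eta>"
proof -
  interpret F: horizontal_transformation C R X F by (rule F)
  show ob: "fob (tob F x) g = fob (phor X g) c" if "g \<in> chom (hor_cat C) x z" for x g
    using F.hor_ob [of g "hid C z"] that z F_c by (simp add: rep_iff)
  fix u g g' \<eta> assume \<eta>: "\<eta> \<in> squares C u g g' (vid C z)"
  \<comment> \<open>\<open>e\<^bsub>1\<^sub>z\<^esub>\<close> is the identity arrow of \<open>1\<^sub>z\<close> in the category \<open>C(z, z)\<close>, hence is sent to \<open>1\<^sub>c\<close>.\<close>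
  have *: "tver F (vid C z) (hid C z) (hid C z) (sqvid C (hid C z)) = cid (pobj X z) c"
    using F.vid_act [of z "sqvid C (hid C z)" "hid C z" "hid C z"] z F_c
      ftor_between.pres_id [OF F.ob_ftor [OF z], of "hid C z"]
    by (simp add: rep_iff)
  have "tver F u (hcomp C (hid C z) g) (hcomp C (hid C z) g') (sqh C (sqvid C (hid C z)) \<eta>) =
      psq X \<eta> c c (cid (pobj X z) c)"
    using F.sq_natural [OF \<eta>, of "hid C z" "hid C z" "sqvid C (hid C z)"] \<eta> z * F_c
    by (auto simp: rep_iff)
  moreover have "hcomp C (hid C z) g = g" "hcomp C (hid C z) g' = g'"
    "sqh C (sqvid C (hid C z)) \<eta> = \<eta>"
    using \<eta> z by (auto simp: squares_iff)
  ultimately show "tver F u g g' \<eta> = elt \<eta>" by (simp add: elt_def)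
qed

end

section \<open>Bijective horizontal transformations are invertible\<close>

locale bijective_transformation =
  double_category C + X: lax_double_presheaf C X + Y: lax_double_presheaf C Y +
  horizontal_transformation C X Y F
  for C :: "('o, 'h, 'v, 's) dcat"
    and X :: "('o, 'h, 'v, 's, 'a, 'm) presheaf" and Y :: "('o, 'h, 'v, 's, 'b, 'n) presheaf"
    and F :: "('o, 'v, 'a, 'm, 'b, 'n) htrans" +
  assumes ob_bij: "x \<in> dobj C \<Longrightarrow> bij_betw (fob (tob F x)) (cobj (pobj X x)) (cobj (pobj Y x))"
    and ver_bij: "\<lbrakk>u \<in> ver C; a \<in> cobj (pobj X (vdom C u)); a' \<in> cobj (pobj X (vcod C u))\<rbrakk>
      \<Longrightarrow> bij_betw (tver F u a a') (pel (pver X u) a a')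
        (pel (pver Y u) (fob (tob F (vdom C u)) a) (fob (tob F (vcod C u)) a'))"
begin

sublocale XC: presheaf_on_double_category C X by unfold_locales
sublocale YC: presheaf_on_double_category C Y by unfold_locales

definition inv_ob :: "'o \<Rightarrow> 'b \<Rightarrow> 'a" where
  "inv_ob x = inv_into (cobj (pobj X x)) (fob (tob F x))"

definition inv_ar :: "'o \<Rightarrow> 'n \<Rightarrow> 'm" where
  "inv_ar x = inv_into (carr (pobj X x)) (far (tob F x))"

definition inv_ver :: "'v \<Rightarrow> 'b \<Rightarrow> 'b \<Rightarrow> 'n \<Rightarrow> 'm" where
  "inv_ver u b b' = inv_into (pel (pver X u) (inv_ob (vdom C u) b) (inv_ob (vcod C u) b'))
    (tver F u (inv_ob (vdom C u) b) (inv_ob (vcod C u) b'))"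

definition inv_trans :: "('o, 'v, 'b, 'n, 'a, 'm) htrans" where
  "inv_trans = \<lparr>tob = (\<lambda>x. \<lparr>fob = inv_ob x, far = inv_ar x\<rparr>), tver = inv_ver\<rparr>"

lemma inv_trans_sel:
  "fob (tob inv_trans x) = inv_ob x" "far (tob inv_trans x) = inv_ar x" "tver inv_trans = inv_ver"
  by (simp_all add: inv_trans_def)

lemma inv_ob:
  assumes "x \<in> dobj C" "b \<in> cobj (pobj Y x)"
  shows "inv_ob x b \<in> cobj (pobj X x)" "fob (tob F x) (inv_ob x b) = b"
  using ob_bij [OF assms(1)] assms(2) unfolding inv_ob_def bij_betw_def
  by (auto intro: inv_into_into f_inv_into_f)

lemma inv_ob_eq:
  assumes "x \<in> dobj C" "a \<in> cobj (pobj X x)" "fob (tob F x) a = b"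
  shows "inv_ob x b = a"
  using bij_betw_inv_into_left [OF ob_bij [OF assms(1)] assms(2)] assms(3) by (simp add: inv_ob_def)

lemma inv_ver:
  assumes "u \<in> ver C" "b \<in> cobj (pobj Y (vdom C u))" "b' \<in> cobj (pobj Y (vcod C u))"
    "t \<in> pel (pver Y u) b b'"
  shows "inv_ver u b b' t \<in> pel (pver X u) (inv_ob (vdom C u) b) (inv_ob (vcod C u) b')"
    and "tver F u (inv_ob (vdom C u) b) (inv_ob (vcod C u) b') (inv_ver u b b' t) = t"
proof -
  have "t \<in> tver F u (inv_ob (vdom C u) b) (inv_ob (vcod C u) b') `
      pel (pver X u) (inv_ob (vdom C u) b) (inv_ob (vcod C u) b')"
    using ver_bij [of u "inv_ob (vdom C u) b" "inv_ob (vcod C u) b'"] inv_ob assms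
    by (simp add: bij_betw_def)
  then show "inv_ver u b b' t \<in> pel (pver X u) (inv_ob (vdom C u) b) (inv_ob (vcod C u) b')"
    and "tver F u (inv_ob (vdom C u) b) (inv_ob (vcod C u) b') (inv_ver u b b' t) = t"
    unfolding inv_ver_def by (rule inv_into_into, rule f_inv_into_f)
qed

lemma inv_ver_eq:
  assumes "u \<in> ver C" "b \<in> cobj (pobj Y (vdom C u))" "b' \<in> cobj (pobj Y (vcod C u))"
    "s \<in> pel (pver X u) (inv_ob (vdom C u) b) (inv_ob (vcod C u) b')"
    "tver F u (inv_ob (vdom C u) b) (inv_ob (vcod C u) b') s = t"
  shows "inv_ver u b b' t = s"
  using bij_betw_inv_into_left [OF ver_bij assms(4)] inv_ob assms by (simp add: inv_ver_def)

lemma far_dom_cod: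
  assumes "x \<in> dobj C" "k \<in> carr (pobj X x)"
  shows "far (tob F x) k \<in> chom (pobj Y x) (fob (tob F x) (cdom (pobj X x) k))
    (fob (tob F x) (ccod (pobj X x) k))"
  using ftor_between.ar_in [OF ob_ftor [OF assms(1)]] assms(2) by (simp add: chom_iff)

text \<open>Over fixed objects, arrows are the elements of the profunctor of \<open>e\<^sub>x\<close>. Distinct hom sets stay
  apart because \<open>F\<close> is injective on objects and preserves domain and codomain.\<close>
lemma ar_bij:
  assumes x: "x \<in> dobj C"
  shows "bij_betw (far (tob F x)) (carr (pobj X x)) (carr (pobj Y x))"
proof -
  interpret A: category "pobj X x" by (rule X.obj_category [OF x])
  interpret B: category "pobj Y x" by (rule Y.obj_category [OF x])
  have hom: "bij_betw (far (tob F x)) (chom (pobj X x) a a')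
      (chom (pobj Y x) (fob (tob F x) a) (fob (tob F x) a'))"
    if "a \<in> cobj (pobj X x)" "a' \<in> cobj (pobj X x)" for a a'
    using ver_bij [of "vid C x" a a'] that x ftor_between.ob_in [OF ob_ftor [OF x]]
      bij_betw_cong [of "chom (pobj X x) a a'" "tver F (vid C x) a a'" "far (tob F x)"]
      vid_act [OF x]
    by (simp add: XC.pel_vid YC.pel_vid)
  show ?thesis unfolding bij_betw_def
  proof
    show "inj_on (far (tob F x)) (carr (pobj X x))"
    proof (rule inj_onI)
      fix k l assume k: "k \<in> carr (pobj X x)" and l: "l \<in> carr (pobj X x)"
        and eq: "far (tob F x) k = far (tob F x) l"
      have "cdom (pobj X x) k = cdom (pobj X x) l" "ccod (pobj X x) k = ccod (pobj X x) l"
        using far_dom_cod [OF x k] far_dom_cod [OF x l] eq A.dom_in A.cod_in k l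
          inj_onD [OF bij_betw_imp_inj_on [OF ob_bij [OF x]]]
        by (simp_all add: chom_iff)
      then show "k = l"
        using hom [OF A.dom_in [OF k] A.cod_in [OF k]] k l eq
        by (simp add: bij_betw_def inj_on_def chom_iff)
    qed
    show "far (tob F x) ` carr (pobj X x) = carr (pobj Y x)"
    proof
      show "far (tob F x) ` carr (pobj X x) \<subseteq> carr (pobj Y x)"
        using far_dom_cod [OF x] by (auto simp: chom_iff)
      show "carr (pobj Y x) \<subseteq> far (tob F x) ` carr (pobj X x)"
      proof
        fix k assume k: "k \<in> carr (pobj Y x)"
        let ?a = "inv_ob x (cdom (pobj Y x) k)" and ?a' = "inv_ob x (ccod (pobj Y x) k)"
        have "k \<in> far (tob F x) ` chom (pobj X x) ?a ?a'"
          using hom [of ?a ?a'] inv_ob [OF x] B.dom_in [OF k] B.cod_in [OF k] k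
          by (simp add: bij_betw_def chom_iff)
        then show "k \<in> far (tob F x) ` carr (pobj X x)" by (auto simp: chom_iff)
      qed
    qed
  qed
qed

lemma inv_ar:
  assumes "x \<in> dobj C" "k \<in> carr (pobj Y x)"
  shows "inv_ar x k \<in> carr (pobj X x)" "far (tob F x) (inv_ar x k) = k"
  using ar_bij [OF assms(1)] assms(2) unfolding inv_ar_def bij_betw_def
  by (auto intro: inv_into_into f_inv_into_f)

lemma inv_ar_eq:
  assumes "x \<in> dobj C" "l \<in> carr (pobj X x)" "far (tob F x) l = k"
  shows "inv_ar x k = l"
  using bij_betw_inv_into_left [OF ar_bij [OF assms(1)] assms(2)] assms(3) by (simp add: inv_ar_def)

lemma inv_ar_in:
  assumes x: "x \<in> dobj C" and k: "k \<in> chom (pobj Y x) b b'"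
  shows "inv_ar x k \<in> chom (pobj X x) (inv_ob x b) (inv_ob x b')"
proof -
  interpret A: category "pobj X x" by (rule X.obj_category [OF x])
  have l: "inv_ar x k \<in> carr (pobj X x)" "far (tob F x) (inv_ar x k) = k"
    using inv_ar [OF x] k by (simp_all add: chom_iff)
  then have "fob (tob F x) (cdom (pobj X x) (inv_ar x k)) = b"
    "fob (tob F x) (ccod (pobj X x) (inv_ar x k)) = b'"
    using far_dom_cod [OF x l(1)] k by (simp_all add: chom_iff)
  then show ?thesis
    using inv_ob_eq [OF x A.dom_in [OF l(1)]] inv_ob_eq [OF x A.cod_in [OF l(1)]] l(1)
    by (simp add: chom_iff)
qed

lemma inv_ob_ftor:
  assumes x: "x \<in> dobj C"
  shows "ftor_between (pobj Y x) (pobj X x) (tob inv_trans x)"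
proof
  interpret A: category "pobj X x" by (rule X.obj_category [OF x])
  interpret Fx: ftor_between "pobj X x" "pobj Y x" "tob F x" by (rule ob_ftor [OF x])
  fix b assume "b \<in> cobj (pobj Y x)"
  note b = inv_ob [OF x this]
  show "fob (tob inv_trans x) b \<in> cobj (pobj X x)" using b by (simp add: inv_trans_sel)
  show "far (tob inv_trans x) (cid (pobj Y x) b) = cid (pobj X x) (fob (tob inv_trans x) b)"
    unfolding inv_trans_sel using b Fx.pres_id [OF b(1)]
    by (intro inv_ar_eq [OF x] A.id_carr) simp_all
next
  fix k b b' assume "k \<in> chom (pobj Y x) b b'"
  then show "far (tob inv_trans x) k \<in> chom (pobj X x) (fob (tob inv_trans x) b) (fob (tob inv_trans x) b')"
    unfolding inv_trans_sel by (rule inv_ar_in [OF x])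
next
  interpret A: category "pobj X x" by (rule X.obj_category [OF x])
  interpret Fx: ftor_between "pobj X x" "pobj Y x" "tob F x" by (rule ob_ftor [OF x])
  fix k b b' l b'' assume k: "k \<in> chom (pobj Y x) b b'" and l: "l \<in> chom (pobj Y x) b' b''"
  show "far (tob inv_trans x) (ccomp (pobj Y x) l k) =
      ccomp (pobj X x) (far (tob inv_trans x) l) (far (tob inv_trans x) k)"
    unfolding inv_trans_sel
  proof (rule inv_ar_eq [OF x])
    note in_X = inv_ar_in [OF x k] inv_ar_in [OF x l]
    show "ccomp (pobj X x) (inv_ar x l) (inv_ar x k) \<in> carr (pobj X x)"
      using A.comp_in [OF in_X] by (simp add: chom_iff)
    show "far (tob F x) (ccomp (pobj X x) (inv_ar x l) (inv_ar x k)) = ccomp (pobj Y x) l k"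
      using Fx.pres_comp [OF in_X] inv_ar(2) [OF x] k l by (simp add: chom_iff)
  qed
qed

lemma inv_ver_nat:
  assumes u: "u \<in> ver C"
  shows "prof_square (pobj Y (vdom C u)) (pobj Y (vcod C u)) (pver Y u)
    (tob inv_trans (vdom C u)) (tob inv_trans (vcod C u)) (pver X u) (tver inv_trans u)"
  unfolding prof_square_def inv_trans_sel
proof (intro conjI ballI)
  fix b b' t assume "b \<in> cobj (pobj Y (vdom C u))" "b' \<in> cobj (pobj Y (vcod C u))" "t \<in> pel (pver Y u) b b'"
  then show "inv_ver u b b' t \<in> pel (pver X u) (inv_ob (vdom C u) b) (inv_ob (vcod C u) b')"
    by (rule inv_ver(1) [OF u])
next
  have ob: "vdom C u \<in> dobj C" "vcod C u \<in> dobj C" using u by simp_all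
  interpret U: profunctor "pobj X (vdom C u)" "pobj X (vcod C u)" "pver X u"
    using u by (rule X.ver_prof)
  fix a b a' b' k l t
  assume b: "a \<in> cobj (pobj Y (vdom C u))" "b \<in> cobj (pobj Y (vdom C u))"
      "a' \<in> cobj (pobj Y (vcod C u))" "b' \<in> cobj (pobj Y (vcod C u))"
    and k: "k \<in> chom (pobj Y (vdom C u)) b a" and l: "l \<in> chom (pobj Y (vcod C u)) a' b'"
    and t: "t \<in> pel (pver Y u) a a'"
  note in_X = inv_ar_in [OF ob(1) k] inv_ar_in [OF ob(2) l] inv_ver(1) [OF u b(1,3) t]
  show "inv_ver u b b' (pact (pver Y u) k l t) =
      pact (pver X u) (inv_ar (vdom C u) k) (inv_ar (vcod C u) l) (inv_ver u a a' t)"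
  proof (rule inv_ver_eq [OF u b(2,4)])
    show "pact (pver X u) (inv_ar (vdom C u) k) (inv_ar (vcod C u) l) (inv_ver u a a' t)
        \<in> pel (pver X u) (inv_ob (vdom C u) b) (inv_ob (vcod C u) b')"
      using in_X by (rule U.act_in)
    have "tver F u (inv_ob (vdom C u) b) (inv_ob (vcod C u) b')
        (pact (pver X u) (inv_ar (vdom C u) k) (inv_ar (vcod C u) l) (inv_ver u a a' t)) =
        pact (pver Y u) (far (tob F (vdom C u)) (inv_ar (vdom C u) k))
          (far (tob F (vcod C u)) (inv_ar (vcod C u) l))
          (tver F u (inv_ob (vdom C u) a) (inv_ob (vcod C u) a') (inv_ver u a a' t))"
      using ver_nat [OF u] in_X inv_ob(1) [OF ob(1)] inv_ob(1) [OF ob(2)] b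
      by (simp add: prof_square_def)
    then show "tver F u (inv_ob (vdom C u) b) (inv_ob (vcod C u) b')
        (pact (pver X u) (inv_ar (vdom C u) k) (inv_ar (vcod C u) l) (inv_ver u a a' t)) =
        pact (pver Y u) k l t"
      using inv_ar(2) [OF ob(1)] inv_ar(2) [OF ob(2)] k l inv_ver(2) [OF u b(1,3) t]
      by (simp add: chom_iff)
  qed
qed

text \<open>Every equation is an instance of \<open>inv_ob_eq\<close>, \<open>inv_ar_eq\<close> or \<open>inv_ver_eq\<close>: its right
  side has the right type and is sent by \<open>F\<close> to the element whose inverse image is on the left, by the
  corresponding equation for \<open>F\<close>.\<close>
lemma inv_transformation: "horizontal_transformation C Y X inv_trans"
proof (rule horizontal_transformation.intro [OF inv_ob_ftor inv_ver_nat]; (unfold inv_trans_sel)?)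
  fix f b assume f: "f \<in> hor C" and b: "b \<in> cobj (pobj Y (hcod C f))"
  then show "inv_ob (hdom C f) (fob (phor Y f) b) = fob (phor X f) (inv_ob (hcod C f) b)"
    using hor_ob [OF f] inv_ob [of "hcod C f" b] by (intro inv_ob_eq) simp_all
next
  fix f k assume f: "f \<in> hor C" and k: "k \<in> carr (pobj Y (hcod C f))"
  then show "inv_ar (hdom C f) (far (phor Y f) k) = far (phor X f) (inv_ar (hcod C f) k)"
    using hor_ar [OF f] inv_ar [of "hcod C f" k] ftor_between.ar_in [OF X.hor_ftor [OF f]]
    by (intro inv_ar_eq) (simp_all add: chom_iff)
next
  fix \<alpha> u f f' v b b' t
  assume sq: "\<alpha> \<in> squares C u f f' v" and b: "b \<in> cobj (pobj Y (hcod C f))"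
    "b' \<in> cobj (pobj Y (hcod C f'))" and t: "t \<in> pel (pver Y v) b b'"
  have \<alpha>: "\<alpha> \<in> sq C" "u = sleft C \<alpha>" "v = sright C \<alpha>" "f = stop C \<alpha>" "f' = sbot C \<alpha>"
    using sq by (simp_all add: squares_iff)
  have in_X: "inv_ob (hcod C f) b \<in> cobj (pobj X (hcod C f))"
    "inv_ob (hcod C f') b' \<in> cobj (pobj X (hcod C f'))"
    "inv_ver v b b' t \<in> pel (pver X v) (inv_ob (hcod C f) b) (inv_ob (hcod C f') b')"
    using inv_ver(1) [of v b b' t] inv_ob(1) b t \<alpha> by simp_all
  have ob: "inv_ob (vdom C u) (fob (phor Y f) b) = fob (phor X f) (inv_ob (hcod C f) b)"
    "inv_ob (vcod C u) (fob (phor Y f') b') = fob (phor X f') (inv_ob (hcod C f') b')"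
    using hor_ob [of f "inv_ob (hcod C f) b"] hor_ob [of f' "inv_ob (hcod C f') b'"] in_X inv_ob(2) b
      XC.hor_ob_in [of f "inv_ob (hcod C f) b"] XC.hor_ob_in [of f' "inv_ob (hcod C f') b'"] \<alpha>
    by (auto intro!: inv_ob_eq)
  show "inv_ver u (fob (phor Y f) b) (fob (phor Y f') b') (psq Y \<alpha> b b' t) =
      psq X \<alpha> (inv_ob (hcod C f) b) (inv_ob (hcod C f') b') (inv_ver v b b' t)"
  proof (rule inv_ver_eq)
    show "u \<in> ver C" using \<alpha> by simp
    show "fob (phor Y f) b \<in> cobj (pobj Y (vdom C u))" "fob (phor Y f') b' \<in> cobj (pobj Y (vcod C u))"
      using YC.hor_ob_in [of f b] YC.hor_ob_in [of f' b'] \<alpha> b by simp_all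
    show "psq X \<alpha> (inv_ob (hcod C f) b) (inv_ob (hcod C f') b') (inv_ver v b b' t)
        \<in> pel (pver X u) (inv_ob (vdom C u) (fob (phor Y f) b)) (inv_ob (vcod C u) (fob (phor Y f') b'))"
      unfolding ob using XC.sq_in [of \<alpha>] in_X \<alpha> by simp
    show "tver F u (inv_ob (vdom C u) (fob (phor Y f) b)) (inv_ob (vcod C u) (fob (phor Y f') b'))
        (psq X \<alpha> (inv_ob (hcod C f) b) (inv_ob (hcod C f') b') (inv_ver v b b' t)) = psq Y \<alpha> b b' t"
      unfolding ob using sq_natural [OF sq in_X] inv_ob(2) inv_ver(2) [of v b b' t] b t \<alpha> by simp
  qed
next
  fix u u' a b c t t'
  assume u: "u \<in> ver C" "u' \<in> ver C" "vcod C u = vdom C u'"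
    and b: "a \<in> cobj (pobj Y (vdom C u))" "b \<in> cobj (pobj Y (vcod C u))" "c \<in> cobj (pobj Y (vcod C u'))"
    and t: "t \<in> pel (pver Y u) a b" "t' \<in> pel (pver Y u') b c"
  let ?a = "inv_ob (vdom C u) a" and ?b = "inv_ob (vcod C u) b" and ?c = "inv_ob (vcod C u') c"
  have in_X: "?a \<in> cobj (pobj X (vdom C u))" "?b \<in> cobj (pobj X (vcod C u))"
    "?c \<in> cobj (pobj X (vcod C u'))"
    "inv_ver u a b t \<in> pel (pver X u) ?a ?b" "inv_ver u' b c t' \<in> pel (pver X u') ?b ?c"
    using u b t inv_ob(1) inv_ver(1) [of u a b t] inv_ver(1) [of u' b c t'] by simp_all
  show "inv_ver (vcomp C u' u) a c (mu_at C Y u u' a c b t' t) =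
      mu_at C X u u' ?a ?c ?b (inv_ver u' b c t') (inv_ver u a b t)"
  proof (rule inv_ver_eq)
    show "mu_at C X u u' ?a ?c ?b (inv_ver u' b c t') (inv_ver u a b t)
        \<in> pel (pver X (vcomp C u' u)) (inv_ob (vdom C (vcomp C u' u)) a) (inv_ob (vcod C (vcomp C u' u)) c)"
      using XC.mu_in [OF u in_X] u by simp
    show "tver F (vcomp C u' u) (inv_ob (vdom C (vcomp C u' u)) a) (inv_ob (vcod C (vcomp C u' u)) c)
        (mu_at C X u u' ?a ?c ?b (inv_ver u' b c t') (inv_ver u a b t)) = mu_at C Y u u' a c b t' t"
      using mu_comp [OF u in_X] u b t inv_ob(2) inv_ver(2) [of u a b t] inv_ver(2) [of u' b c t']
      by simp
  qed (use u b in simp_all)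
next
  fix x k a b assume x: "x \<in> dobj C" and k: "k \<in> chom (pobj Y x) a b"
  show "inv_ver (vid C x) a b k = inv_ar x k"
  proof (rule inv_ver_eq)
    show "inv_ar x k \<in> pel (pver X (vid C x)) (inv_ob (vdom C (vid C x)) a) (inv_ob (vcod C (vid C x)) b)"
      using inv_ar_in [OF x k] XC.chom_objects [OF x inv_ar_in [OF x k]] x by (simp add: XC.pel_vid)
    show "tver F (vid C x) (inv_ob (vdom C (vid C x)) a) (inv_ob (vcod C (vid C x)) b) (inv_ar x k) = k"
      using vid_act [OF x inv_ar_in [OF x k]] inv_ar(2) [OF x] k x by (simp add: chom_iff)
  qed (use x YC.chom_objects [OF x k] in simp_all)
qed

lemma bijective_imp_presheaf_iso: "presheaf_iso C X Y"
proof -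
  have "is_id_htrans C X (htrans_comp C inv_trans F)"
    unfolding is_id_htrans_def htrans_comp_def
    using inv_ob_eq inv_ar_eq ftor_between.ob_in [OF ob_ftor] ver_nat
    by (auto simp: inv_trans_sel prof_square_def intro!: inv_ver_eq)
  moreover have "is_id_htrans C Y (htrans_comp C F inv_trans)"
    unfolding is_id_htrans_def htrans_comp_def
    by (auto simp: inv_trans_sel inv_ob inv_ar inv_ver)
  ultimately show ?thesis
    unfolding presheaf_iso_def using inv_transformation horizontal_transformation_axioms by blast
qed

end

section \<open>Representability and terminal objects\<close>

text \<open>Morphisms and squares of the Grothendieck construction are tuples with redundant entries; this
  reduces unique existence of a tuple to that of its essential entry.\<close>
lemma ex1_image:
  assumes "inj i"
  shows "(\<exists>!y. \<exists>x. P x \<and> y = i x) \<longleftrightarrow> (\<exists>!x. P x)"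
  using injD [OF assms] by metis

lemma bij_betw_iff_unique_preimage:
  assumes "f ` A \<subseteq> B"
  shows "bij_betw f A B \<longleftrightarrow> (\<forall>b\<in>B. \<exists>!a. a \<in> A \<and> f a = b)"
proof
  assume "bij_betw f A B"
  then show "\<forall>b\<in>B. \<exists>!a. a \<in> A \<and> f a = b" unfolding bij_betw_def inj_on_def by blast
next
  assume unique: "\<forall>b\<in>B. \<exists>!a. a \<in> A \<and> f a = b"
  then have "inj_on f A" using assms by (intro inj_onI) (metis image_subset_iff)
  moreover have "B \<subseteq> f ` A" using unique by blast
  ultimately show "bij_betw f A B" using assms unfolding bij_betw_def by blast
qed

context presheaf_with_element
begin

lemma yoneda_bijective_imp_iso:
  assumes yoneda_bijective
  shows "presheaf_iso C R X"
proof -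
  interpret Y: horizontal_transformation C R X yoneda_trans by (rule yoneda_transformation)
  interpret R: lax_double_presheaf C R by (rule rep_lax_double_presheaf)
  interpret bijective_transformation C R X yoneda_trans
    using assms by unfold_locales (auto simp: yoneda_bijective_def yoneda_trans_def rep_sel)
  show ?thesis by (rule bijective_imp_presheaf_iso)
qed

text \<open>By the Yoneda argument \<open>F\<close> is the transformation given by \<open>c\<close>, and the components of \<open>G\<close>
  invert it.\<close>
lemma inverse_imp_yoneda_bijective:
  assumes F: "horizontal_transformation C R X F" and G: "horizontal_transformation C X R G"
    and GF: "is_id_htrans C R (htrans_comp C G F)" and FG: "is_id_htrans C X (htrans_comp C F G)"
    and F_c: "fob (tob F z) (hid C z) = c"
  shows yoneda_bijective
  unfolding yoneda_bijective_def
proof (intro conjI ballI)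
  interpret F: horizontal_transformation C R X F by (rule F)
  interpret G: horizontal_transformation C X R G by (rule G)
  note F_eq = transformation_eq_yoneda [OF F F_c]
  have GF_ob: "fob (tob G x) (fob (phor X g) c) = g"
    if "x \<in> dobj C" "g \<in> chom (hor_cat C) x z" for x g
    using GF that(1) bspec [of _ _ g] that(2) F_eq(1) [OF that(2)]
    by (fastforce simp: is_id_htrans_def htrans_comp_def rep_sel)
  have FG_ob: "fob (phor X (fob (tob G x) a)) c = a" if "x \<in> dobj C" "a \<in> cobj (pobj X x)" for x a
    using FG that F_eq(1) [of "fob (tob G x) a" x] ftor_between.ob_in [OF G.ob_ftor [OF that(1)] that(2)]
    by (simp add: is_id_htrans_def htrans_comp_def rep_sel)
  fix x assume x: "x \<in> dobj C"
  show "bij_betw (\<lambda>g. fob (phor X g) c) (chom (hor_cat C) x z) (cobj (pobj X x))"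
  proof (rule bij_betw_byWitness [where f' = "fob (tob G x)"])
    show "(\<lambda>g. fob (phor X g) c) ` chom (hor_cat C) x z \<subseteq> cobj (pobj X x)"
      using hor_ob_in c by (auto simp: chom_iff)
    show "fob (tob G x) ` cobj (pobj X x) \<subseteq> chom (hor_cat C) x z"
      using ftor_between.ob_in [OF G.ob_ftor [OF x]] by (auto simp: rep_sel)
  qed (use GF_ob [OF x] FG_ob [OF x] in auto)
next
  interpret F: horizontal_transformation C R X F by (rule F)
  interpret G: horizontal_transformation C X R G by (rule G)
  note F_eq = transformation_eq_yoneda [OF F F_c]
  fix u g g'
  assume u: "u \<in> ver C" and g: "g \<in> chom (hor_cat C) (vdom C u) z" "g' \<in> chom (hor_cat C) (vcod C u) z"
  have u_ob: "vdom C u \<in> dobj C" "vcod C u \<in> dobj C" using u by simp_all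
  let ?a = "fob (phor X g) c" and ?a' = "fob (phor X g') c"
  have G_ob: "fob (tob G (vdom C u)) ?a = g" "fob (tob G (vcod C u)) ?a' = g'"
    using GF u_ob g F_eq(1) by (simp_all add: is_id_htrans_def htrans_comp_def rep_sel)
  have a: "?a \<in> cobj (pobj X (vdom C u))" "?a' \<in> cobj (pobj X (vcod C u))"
    using g hor_ob_in [of g c] hor_ob_in [of g' c] c by (simp_all add: chom_iff)
  show "bij_betw elt (squares C u g g' (vid C z)) (pel (pver X u) ?a ?a')"
  proof (rule bij_betw_byWitness [where f' = "tver G u ?a ?a'"])
    show "\<forall>\<eta>\<in>squares C u g g' (vid C z). tver G u ?a ?a' (elt \<eta>) = \<eta>"
      using GF u g F_eq by (simp add: is_id_htrans_def htrans_comp_def rep_sel)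
    show G_in: "tver G u ?a ?a' ` pel (pver X u) ?a ?a' \<subseteq> squares C u g g' (vid C z)"
    proof (rule image_subsetI)
      fix p assume "p \<in> pel (pver X u) ?a ?a'"
      then have "tver G u ?a ?a' p \<in> squares C u (fob (tob G (vdom C u)) ?a)
          (fob (tob G (vcod C u)) ?a') (vid C z)"
        using G.ver_nat [OF u] a by (simp add: prof_square_def rep_sel)
      then show "tver G u ?a ?a' p \<in> squares C u g g' (vid C z)" unfolding G_ob .
    qed
    show "\<forall>p\<in>pel (pver X u) ?a ?a'. elt (tver G u ?a ?a' p) = p"
    proof
      fix p assume p: "p \<in> pel (pver X u) ?a ?a'"
      then have "tver G u ?a ?a' p \<in> squares C u g g' (vid C z)" using G_in by blast
      then have "tver F u g g' (tver G u ?a ?a' p) = elt (tver G u ?a ?a' p)" by (rule F_eq(2))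
      moreover have "tver F u (fob (tob G (vdom C u)) ?a) (fob (tob G (vcod C u)) ?a')
          (tver G u ?a ?a' p) = p"
        using FG u a p by (simp add: is_id_htrans_def htrans_comp_def)
      ultimately show "elt (tver G u ?a ?a' p) = p" unfolding G_ob by simp
    qed
    show "elt ` squares C u g g' (vid C z) \<subseteq> pel (pver X u) ?a ?a'"
      using elt_in by (auto simp: squares_iff)
  qed
qed

lemma groth_hor_to_element:
  "h \<in> hor (groth C X) \<and> hdom (groth C X) h = (x, a) \<and> hcod (groth C X) h = (z, c) \<longleftrightarrow>
    (\<exists>g. (g \<in> chom (hor_cat C) x z \<and> fob (phor X g) c = a) \<and> h = (a, g, c))"
  using c by (cases h) (auto simp: groth_sel chom_iff)

lemma groth_sq_to_element:
  assumes U: "(a, u, p, a') \<in> ver (groth C X)"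
  shows "\<sigma> \<in> sq (groth C X) \<and> sleft (groth C X) \<sigma> = (a, u, p, a') \<and>
      sright (groth C X) \<sigma> = vid (groth C X) (z, c) \<longleftrightarrow>
    (\<exists>\<eta>. (\<eta> \<in> sq C \<and> sleft C \<eta> = u \<and> sright C \<eta> = vid C z \<and>
      fob (phor X (stop C \<eta>)) c = a \<and> fob (phor X (sbot C \<eta>)) c = a' \<and> elt \<eta> = p) \<and>
      \<sigma> = ((a, u, p, a'), \<eta>, vid (groth C X) (z, c)))"
proof -
  obtain V \<eta> W where \<sigma>: "\<sigma> = (V, \<eta>, W)" by (cases \<sigma>)
  have "(c, vid C z, cid (pobj X z) c, c) \<in> ver (groth C X)"
    using c z by (simp add: groth_sel cid_in_vid)
  then show ?thesis
    using U unfolding \<sigma> groth_sel(10,12,13,14) by (auto simp: elt_def)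
qed

text \<open>On objects, unique existence of fillers is bijectivity word for word. For squares there is a
  difference: a filler of \<open>(u, p)\<close> is a square with any top and bottom that have the prescribed
  images, whereas the component of the transformation fixes top and bottom. Injectivity on objects
  identifies the two conditions.\<close>
lemma double_terminal_iff_yoneda_bijective:
  "double_terminal (groth C X) (z, c) \<longleftrightarrow> yoneda_bijective"
proof -
  interpret E: double_category "groth C X" by (rule groth_double_category)
  let ?hom = "\<lambda>x a g. g \<in> chom (hor_cat C) x z \<and> fob (phor X g) c = a"
  let ?sq = "\<lambda>a u p a' \<eta>. \<eta> \<in> sq C \<and> sleft C \<eta> = u \<and> sright C \<eta> = vid C z \<and>
    fob (phor X (stop C \<eta>)) c = a \<and> fob (phor X (sbot C \<eta>)) c = a' \<and> elt \<eta> = p"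
  have hom: "(\<exists>!h. h \<in> hor (groth C X) \<and> hdom (groth C X) h = (x, a) \<and> hcod (groth C X) h = (z, c))
      \<longleftrightarrow> (\<exists>!g. ?hom x a g)" for x a
    unfolding groth_hor_to_element by (rule ex1_image) (simp add: inj_def)
  have sq: "(\<exists>!\<sigma>. \<sigma> \<in> sq (groth C X) \<and> sleft (groth C X) \<sigma> = (a, u, p, a') \<and>
      sright (groth C X) \<sigma> = vid (groth C X) (z, c)) \<longleftrightarrow> (\<exists>!\<eta>. ?sq a u p a' \<eta>)"
    if "(a, u, p, a') \<in> ver (groth C X)" for a u p a'
    unfolding groth_sq_to_element [OF that] by (rule ex1_image) (simp add: inj_def)
  have "double_terminal (groth C X) (z, c) \<longleftrightarrow>
    (\<forall>x\<in>dobj C. \<forall>a\<in>cobj (pobj X x). \<exists>!g. ?hom x a g) \<and>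
    (\<forall>u\<in>ver C. \<forall>a\<in>cobj (pobj X (vdom C u)). \<forall>a'\<in>cobj (pobj X (vcod C u)).
      \<forall>p\<in>pel (pver X u) a a'. \<exists>!\<eta>. ?sq a u p a' \<eta>)"
    (is "_ \<longleftrightarrow> ?H \<and> ?S")
  proof -
    have "(\<forall>e\<in>dobj (groth C X). \<exists>!h. h \<in> hor (groth C X) \<and> hdom (groth C X) h = e \<and>
        hcod (groth C X) h = (z, c)) \<longleftrightarrow> ?H"
      unfolding groth_sel(1) Ball_def split_paired_All hom by (simp add: imp_conjL)
    moreover have "(\<forall>U\<in>ver (groth C X). \<exists>!\<sigma>. \<sigma> \<in> sq (groth C X) \<and> sleft (groth C X) \<sigma> = U \<and>
        sright (groth C X) \<sigma> = vid (groth C X) (z, c)) \<longleftrightarrow>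
      (\<forall>a u p a'. (a, u, p, a') \<in> ver (groth C X) \<longrightarrow> (\<exists>!\<eta>. ?sq a u p a' \<eta>))"
      unfolding Ball_def split_paired_All by (simp add: sq cong: imp_cong)
    moreover have "\<dots> \<longleftrightarrow> ?S" unfolding groth_sel(7) by simp blast
    moreover have "(z, c) \<in> dobj (groth C X)" using z c by (simp add: groth_sel)
    ultimately show ?thesis unfolding E.double_terminal_iff_unique by simp
  qed
  also have "\<dots> \<longleftrightarrow> yoneda_bijective"
    unfolding yoneda_bijective_def
  proof (rule conj_cong)
    have "bij_betw (\<lambda>g. fob (phor X g) c) (chom (hor_cat C) x z) (cobj (pobj X x)) \<longleftrightarrow>
        (\<forall>a\<in>cobj (pobj X x). \<exists>!g. ?hom x a g)" for x
      using hor_ob_in c by (intro bij_betw_iff_unique_preimage) (auto simp: chom_iff)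
    then show "?H \<longleftrightarrow> (\<forall>x\<in>dobj C.
        bij_betw (\<lambda>g. fob (phor X g) c) (chom (hor_cat C) x z) (cobj (pobj X x)))" by simp
    assume ob_bij: "\<forall>x\<in>dobj C.
      bij_betw (\<lambda>g. fob (phor X g) c) (chom (hor_cat C) x z) (cobj (pobj X x))"
    have inj: "fob (phor X g) c = fob (phor X g') c \<longleftrightarrow> g = g'"
      if "x \<in> dobj C" "g \<in> chom (hor_cat C) x z" "g' \<in> chom (hor_cat C) x z" for x g g'
      using that bspec [OF ob_bij that(1)] by (auto simp: bij_betw_def inj_on_def)
    have sq_bij: "(\<forall>p\<in>pel (pver X u) (fob (phor X g) c) (fob (phor X g') c).
          \<exists>!\<eta>. ?sq (fob (phor X g) c) u p (fob (phor X g') c) \<eta>) \<longleftrightarrow>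
        bij_betw elt (squares C u g g' (vid C z))
          (pel (pver X u) (fob (phor X g) c) (fob (phor X g') c))"
      if u: "u \<in> ver C" and g: "g \<in> chom (hor_cat C) (vdom C u) z"
        and g': "g' \<in> chom (hor_cat C) (vcod C u) z" for u g g'
    proof -
      have sq_iff: "?sq (fob (phor X g) c) u p (fob (phor X g') c) \<eta> \<longleftrightarrow>
          \<eta> \<in> squares C u g g' (vid C z) \<and> elt \<eta> = p" for p \<eta>
        using inj [of "vdom C u" "stop C \<eta>" g] inj [of "vcod C u" "sbot C \<eta>" g'] u g g' z
        by (auto simp: chom_iff squares_iff)
      have "elt ` squares C u g g' (vid C z)
          \<subseteq> pel (pver X u) (fob (phor X g) c) (fob (phor X g') c)"
        using elt_in by (auto simp: squares_iff)
      then show ?thesis unfolding sq_iff by (rule bij_betw_iff_unique_preimage [symmetric])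
    qed
    have ob_image: "cobj (pobj X x) = (\<lambda>g. fob (phor X g) c) ` chom (hor_cat C) x z"
      if "x \<in> dobj C" for x
      using bspec [OF ob_bij that] by (simp add: bij_betw_def)
    show "?S \<longleftrightarrow> (\<forall>u\<in>ver C. \<forall>g\<in>chom (hor_cat C) (vdom C u) z. \<forall>g'\<in>chom (hor_cat C) (vcod C u) z.
        bij_betw elt (squares C u g g' (vid C z))
          (pel (pver X u) (fob (phor X g) c) (fob (phor X g') c)))"
      by (rule ball_cong [OF refl]) (simp add: ob_image sq_bij)
  qed
  finally show ?thesis .
qed

end

theorem theorem3:
  fixes C :: "('o, 'h, 'v, 's) dcat"
    and X :: "('o, 'h, 'v, 's, 'a, 'm) presheaf"
  assumes "double_category C"
    and "lax_double_presheaf C X"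
  shows "(\<exists>z. represented_by C X z) \<longleftrightarrow> (\<exists>e. double_terminal (groth C X) e)"
proof
  interpret presheaf_on_double_category C X
    using assms by (rule presheaf_on_double_category.intro)
  assume "\<exists>z. represented_by C X z"
  then obtain z F G where z: "z \<in> dobj C"
    and FG: "horizontal_transformation C (representable C z) X F"
      "horizontal_transformation C X (representable C z) G"
      "is_id_htrans C (representable C z) (htrans_comp C G F)" "is_id_htrans C X (htrans_comp C F G)"
    unfolding represented_by_def presheaf_iso_def by blast
  interpret representable_at C z by unfold_locales (rule z)
  interpret presheaf_with_element C X z "fob (tob F z) (hid C z)"
    using z ftor_between.ob_in [OF horizontal_transformation.ob_ftor [OF FG(1) z], of "hid C z"]
    by unfold_locales (simp_all add: rep_iff)
  show "\<exists>e. double_terminal (groth C X) e"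
    using double_terminal_iff_yoneda_bijective inverse_imp_yoneda_bijective [OF FG] by blast
next
  interpret presheaf_on_double_category C X
    using assms by (rule presheaf_on_double_category.intro)
  assume "\<exists>e. double_terminal (groth C X) e"
  then obtain z c where e: "double_terminal (groth C X) (z, c)" by auto
  then have "(z, c) \<in> dobj (groth C X)" by (simp add: double_terminal_def)
  then interpret presheaf_with_element C X z c
    by unfold_locales (simp_all add: groth_sel)
  show "\<exists>z. represented_by C X z"
    unfolding represented_by_def
    using z yoneda_bijective_imp_iso e double_terminal_iff_yoneda_bijective by blast
qed

end
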